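(* Fix constants $\gamma\in[0,1)$, $\alpha$ with $\frac{1+\gamma}{2}<\alpha<1$, and $r>0$. Let $p\to\infty$ through positive integers, with $N=p^{1-\gamma}$ and $s=p^{1-\alpha}$ (positive integers). Consider the model $\mathbf{y}=\mathbf{X}\boldsymbol{\beta}+\mathbf{z}$ with the $N\times p$ extended discrete Fourier transform design matrix $\mathbf{X}$, and the problem of testing $H_0:\boldsymbol{\beta}=\mathbf{0}$ against the alternatives $(\boldsymbol{\tau},\tilde{\boldsymbol{\beta}})\in\Gamma(p,N,s,r)$. Consider the over-sampled periodogram higher criticism (OPHC) test with $q=N\lfloor \log N+1\rfloor$ and $[a,b]=\bigl[1,\sqrt{\log\frac N3}\bigr]$, which rejects $H_0$ if and only if $\mathrm{HC}^*>\log^2 N$. If $r>\rho^*_\gamma(\alpha)$, then this test is asymptotically powerful: $$\lim_{N\to\infty}\Bigl(\mathbb{P}_0(H_0\text{ is rejected})+\max_{(\boldsymbol{\tau},\tilde{\boldsymbol{\beta}})\in\Gamma(p,N,s,r)}\mathbb{P}_{(\boldsymbol{\tau},\tilde{\boldsymbol{\beta}})}(H_0\text{ is accepted})\Bigr)=0.$$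
   Context: Model. $\mathbf{y}=\mathbf{X}\boldsymbol{\beta}+\mathbf{z}\in\mathbb{C}^N$, where $\mathbf{X}\in\mathbb{C}^{N\times p}$ has entries $X_{jk}=\frac{1}{\sqrt p}e^{-2\pi i(k-1)(j-1)/p}$ for $1\le j\le N$, $1\le k\le p$; $\boldsymbol{\beta}\in\mathbb{C}^p$ is an unknown deterministic vector; and $\mathbf{z}=(z_1,\dots,z_N)$ has i.i.d. standard complex normal entries, i.e. $z_t=z_{1t}+iz_{2t}$ with $z_{1t},z_{2t}$ independent real $\mathcal{N}(0,1/2)$ variables. Parametrization. Under the alternative, $\boldsymbol{\beta}$ has support $\{\tau_1,\dots,\tau_s\}$ with $1\le\tau_1<\cdots<\tau_s\le p$. Write $\boldsymbol{\tau}=(\tau_1,\dots,\tau_s)$ and $\tilde{\boldsymbol{\beta}}=(\tilde\beta_1,\dots,\tilde\beta_s)=(\beta_{\tau_1},\dots,\beta_{\tau_s})$. $\mathbb{P}_{(\boldsymbol{\tau},\tilde{\boldsymbol{\beta}})}$ denotes the law of $\mathbf{y}$ under this $\boldsymbol{\beta}$, and $\mathbb{P}_0$ the law of $\mathbf{y}$ when $\boldsymbol{\beta}=\mathbf{0}$. Minimum separation. $\Delta(\boldsymbol{\tau})=\frac1p\min\{|\tau_{l+1}-\tau_l|: l=1,\dots,s\}$ with the convention $\tau_{s+1}:=\tau_1+p$. Parameter space. $\Gamma(p,N,s,r)$ is the set of all $(\boldsymbol{\tau},\tilde{\boldsymbol{\beta}})$ (with $\boldsymbol\tau$ of length $s$,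 strictly increasing in $\{1,\dots,p\}$, and $\tilde{\boldsymbol\beta}\in\mathbb{C}^s$) such that $|\tilde\beta_1|=\cdots=|\tilde\beta_s|=\sqrt{\frac{r\,p\log p}{N}}$ and $\Delta(\boldsymbol{\tau})\ge\frac{\log^2N}{N}$. Here $\log^2 N=(\log N)^2$. Test statistic. For an integer $q$ let $\mathbf{U}\in\mathbb{C}^{q\times N}$ have entries $U_{mj}=\frac{1}{\sqrt N}e^{2\pi i(m-1)(j-1)/q}$, let $\mathbf{v}=\mathbf{U}\mathbf{y}$ and $I_m=|v_m|^2$ for $m=1,\dots,q$. With $\bar\Psi(t)=e^{-t^2}$, define $$\mathrm{HC}(t)=\frac{\sum_{m=1}^q 1_{\{\sqrt{I_m}\ge t\}}-q\bar\Psi(t)}{\sqrt{q\bar\Psi(t)(1-\bar\Psi(t))}},\qquad \mathrm{HC}^*=\sup_{a\le t\le b}\mathrm{HC}(t).$$ Detection boundary. $$\rho^*_\gamma(\alpha)=\begin{cases}\bigl(\sqrt{1-\gamma}-\sqrt{1-\alpha}\bigr)^2,&\alpha\in\bigl[\frac34+\frac\gamma4,1\bigr),\\ \alpha-\frac12-\frac\gamma2,&\alpha\in\bigl[\frac{1+\gamma}{2},\frac34+\frac\gamma4\bigr).\end{cases}$$ Integrality convention: $N=p^{1-\gamma}$ and $s=p^{1-\alpha}$ are integers, so the limit is along those $p$ for which this holds. *)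

theory Defs
  imports "HOL-Probability.Probability"
begin

text \<open>
  Vectors in \<open>\<complex>\<^sup>n\<close> are functions \<open>nat \<Rightarrow> complex\<close> of which only the values on the
  index set \<open>{1..n}\<close> are used; indices start at 1. All logarithms are natural.
\<close>

definition design :: "nat \<Rightarrow> nat \<Rightarrow> nat \<Rightarrow> complex" where
  "design p j k =
     complex_of_real (1 / sqrt (real p)) *
     exp (- 2 * of_real pi * \<i> * (of_nat k - 1) * (of_nat j - 1) / of_nat p)"

text \<open>Standard complex normal law: real and imaginary part are independent \<open>N(0,1/2)\<close>.
  The second parameter of \<^const>\<open>normal_density\<close> is the standard deviation.\<close>

definition half_normal :: "real measure" where
  "half_normal = density lborel (normal_density 0 (sqrt (1 / 2)))"

definition std_complex_normal :: "complex measure" where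
  "std_complex_normal = distr (half_normal \<Otimes>\<^sub>M half_normal) borel (\<lambda>(a, b). Complex a b)"

definition noise :: "nat \<Rightarrow> (nat \<Rightarrow> complex) measure" where
  "noise N = (\<Pi>\<^sub>M t\<in>{1..N}. std_complex_normal)"

text \<open>The law of \<open>y = X \<beta> + z\<close> on \<open>\<complex>\<^sup>N\<close>.\<close>

definition obs_law :: "nat \<Rightarrow> nat \<Rightarrow> (nat \<Rightarrow> complex) \<Rightarrow> (nat \<Rightarrow> complex) measure" where
  "obs_law p N \<beta> =
     distr (noise N) (\<Pi>\<^sub>M j\<in>{1..N}. borel)
       (\<lambda>z. \<lambda>j\<in>{1..N}. (\<Sum>k=1..p. design p j k * \<beta> k) + z j)"

text \<open>The vector \<open>\<beta>\<close> with \<open>\<beta> (\<tau> l) = b l\<close> for \<open>l = 1, \<dots>, s\<close> and \<open>\<beta> k = 0\<close> elsewhere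
  (for \<open>\<tau>\<close> injective on \<open>{1..s}\<close> the sum has at most one term).\<close>

definition signal :: "nat \<Rightarrow> (nat \<Rightarrow> nat) \<Rightarrow> (nat \<Rightarrow> complex) \<Rightarrow> nat \<Rightarrow> complex" where
  "signal s \<tau> b k = (\<Sum>l\<in>{l \<in> {1..s}. \<tau> l = k}. b l)"

text \<open>The convention \<open>\<tau>\<^sub>s\<^sub>+\<^sub>1 = \<tau>\<^sub>1 + p\<close>.\<close>

definition cyc_ext :: "nat \<Rightarrow> nat \<Rightarrow> (nat \<Rightarrow> nat) \<Rightarrow> nat \<Rightarrow> nat" where
  "cyc_ext p s \<tau> l = (if l = s + 1 then \<tau> 1 + p else \<tau> l)"

definition min_sep :: "nat \<Rightarrow> nat \<Rightarrow> (nat \<Rightarrow> nat) \<Rightarrow> real" where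
  "min_sep p s \<tau> =
     1 / real p * Min ((\<lambda>l. \<bar>real (cyc_ext p s \<tau> (l + 1)) - real (cyc_ext p s \<tau> l)\<bar>) ` {1..s})"

definition param_space ::
    "nat \<Rightarrow> nat \<Rightarrow> nat \<Rightarrow> real \<Rightarrow> ((nat \<Rightarrow> nat) \<times> (nat \<Rightarrow> complex)) set" where
  "param_space p N s r =
     {(\<tau>, b). \<tau> \<in> {1..s} \<rightarrow>\<^sub>E {1..p} \<and> strict_mono_on {1..s} \<tau> \<and>
        b \<in> {1..s} \<rightarrow>\<^sub>E UNIV \<and>
        (\<forall>l\<in>{1..s}. cmod (b l) = sqrt (r * real p * ln (real p) / real N)) \<and>
        min_sep p s \<tau> \<ge> (ln (real N))\<^sup>2 / real N}"

definition oversampled_dft :: "nat \<Rightarrow> nat \<Rightarrow> nat \<Rightarrow> nat \<Rightarrow> complex" where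
  "oversampled_dft q N m j =
     complex_of_real (1 / sqrt (real N)) *
     exp (2 * of_real pi * \<i> * (of_nat m - 1) * (of_nat j - 1) / of_nat q)"

definition periodogram :: "nat \<Rightarrow> nat \<Rightarrow> (nat \<Rightarrow> complex) \<Rightarrow> nat \<Rightarrow> real" where
  "periodogram q N y m = (cmod (\<Sum>j=1..N. oversampled_dft q N m j * y j))\<^sup>2"

definition Psi_bar :: "real \<Rightarrow> real" where
  "Psi_bar t = exp (- t\<^sup>2)"

definition HC :: "nat \<Rightarrow> nat \<Rightarrow> (nat \<Rightarrow> complex) \<Rightarrow> real \<Rightarrow> real" where
  "HC q N y t =
     ((\<Sum>m=1..q. of_bool (sqrt (periodogram q N y m) \<ge> t)) - real q * Psi_bar t) /
     sqrt (real q * Psi_bar t * (1 - Psi_bar t))"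

definition HC_star :: "nat \<Rightarrow> nat \<Rightarrow> real \<Rightarrow> real \<Rightarrow> (nat \<Rightarrow> complex) \<Rightarrow> real" where
  "HC_star q N a b y = (SUP t\<in>{a..b}. HC q N y t)"

text \<open>The OPHC test: \<open>ophc_rejects N y\<close> holds iff the null hypothesis is rejected on data \<open>y\<close>.
  The range of thresholds is nonempty as soon as \<open>N \<ge> 9\<close>.\<close>

definition ophc_rejects :: "nat \<Rightarrow> (nat \<Rightarrow> complex) \<Rightarrow> bool" where
  "ophc_rejects N y \<longleftrightarrow>
     HC_star (N * nat \<lfloor>ln (real N) + 1\<rfloor>) N 1 (sqrt (ln (real N / 3))) y > (ln (real N))\<^sup>2"

text \<open>Only meant for \<open>(1 + \<gamma>) / 2 \<le> \<alpha> < 1\<close>.\<close>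

definition detection_boundary :: "real \<Rightarrow> real \<Rightarrow> real" where
  "detection_boundary \<gamma> \<alpha> =
     (if 3 / 4 + \<gamma> / 4 \<le> \<alpha> then (sqrt (1 - \<gamma>) - sqrt (1 - \<alpha>))\<^sup>2
      else \<alpha> - 1 / 2 - \<gamma> / 2)"

end

theory Submission
  imports Defs
begin

text \<open>
  Two features of the statistic carry the proof. Write \<open>L\<close> for the oversampling factor
  \<open>\<lfloor>ln N + 1\<rfloor>\<close>, so that \<open>q = N L\<close>.

  First, the \<open>q\<close> frequencies split into \<open>L\<close> residue classes, each of them a shifted copy of the
  ordinary Fourier grid. Within a class the noise coefficients are an orthonormal transform of
  \<open>z\<close>, hence independent standard complex normals (\<open>law_spectrum_residue_class\<close>). The classes depend
  on each other, but there are only about \<open>ln N\<close> of them: a union bound over the classes, or the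
  Cauchy--Schwarz inequality for their sum, costs a logarithmic factor, and the rejection threshold
  \<open>(ln N)\<^sup>2\<close> is large enough to absorb it.

  Secondly, \<open>\<bar>\<mu> + z\<bar>\<close> exceeds a level with at least the probability with which \<open>\<bar>z\<bar>\<close> does, for
  every centre \<open>\<mu>\<close> (\<open>gauss_tail_ge_central\<close>). Under an alternative every frequency thus has a
  nonnegative expected excess, and it suffices to bound the excess of the \<open>s\<close> frequencies next to
  the support of \<open>\<beta>\<close>.

  Under the null hypothesis a rejection forces, in one class and at one of the levels \<open>t\<close> with
  \<open>N exp (- t\<^sup>2) = i \<in> {3..N}\<close>, the count of exceedances to exceed its mean by a
  number of standard deviations of the order \<open>(ln N)\<^bsup>3/2\<^esup>\<close>. Chernoff's bound makes each of these \<open>L N\<close> events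
  superpolynomially unlikely (\<open>null_rejection_le\<close>).

  Under an alternative the variance of the total count is at most \<open>L\<close> times its mean, so by
  Chebyshev's inequality the test rejects as soon as, at one level \<open>t\<close>, the expected excess is
  at least \<open>2 (ln N)\<^sup>2 sqrt (q exp (- t\<^sup>2))\<close> (\<open>alternative_acceptance_le\<close>). The mean of the spectrum
  is a sum of Dirichlet kernels centred at the support points. At the grid point next to a
  support point its own kernel is \<open>1 - O(1 / ln N)\<close>, and the separation \<open>(ln N)\<^sup>2 / N\<close> makes the others
  add up to \<open>O(1 / ln N)\<close>; so for every \<open>\<rho> < r / (1 - \<gamma>)\<close> the mean there is eventually at
  least \<open>sqrt (\<rho> ln N)\<close> in modulus (\<open>spectrum_at_bin_below\<close>). With \<open>s = N\<^bsup>\<sigma>\<^esup>\<close> and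
  \<open>t = sqrt (c ln N)\<close>, the excess is \<open>N\<close> to the power \<open>\<sigma> - (max 0 (sqrt c - sqrt \<rho>))\<^sup>2\<close> up to lower
  order terms, and it has to beat \<open>N\<close> to the power \<open>(1 - c) / 2\<close>. The best \<open>c \<le> 1\<close> is \<open>4 \<rho>\<close> when this is
  at most 1, and 1 otherwise; these two regimes are the two branches of the detection boundary
  (\<open>exponents_exist\<close>).
\<close>

section \<open>Joint laws from characteristic functions\<close>

text \<open>
  Levy's uniqueness theorem holds under a complex weight \<open>h\<close> as well. It needs positive measures, so
  \<open>h\<close> is replaced by the densities \<open>2 + Re (e h)\<close> with \<open>\<bar>e\<bar> = 1\<close>; the values \<open>e = 1\<close> and
  \<open>e = - \<i>\<close> give back its real and imaginary part. The weight is there to hold characters and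
  indicators of further random variables.
\<close>

lemma (in prob_space) weighted_law_eqI:
  fixes X :: "'a \<Rightarrow> real" and h :: "'a \<Rightarrow> complex" and c :: complex
  assumes X [measurable]: "X \<in> borel_measurable M"
    and h [measurable]: "h \<in> borel_measurable M"
    and h_bound: "\<And>x. norm (h x) \<le> 1"
    and mu: "real_distribution \<mu>"
    and char_X: "\<And>a. (\<integral>x. iexp (a * X x) \<partial>M) = char \<mu> a"
    and char_hX: "\<And>a. (\<integral>x. h x * iexp (a * X x) \<partial>M) = c * char \<mu> a"
    and A: "A \<in> sets borel"
  shows "(\<integral>x. h x * indicator A (X x) \<partial>M) = c * measure \<mu> A"
proof -
  interpret mu: real_distribution \<mu> by (rule mu)
  have cnj_meas [measurable]: "cnj \<in> borel_measurable borel"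
    by (intro borel_measurable_continuous_onI continuous_intros)
  have real_case: "(\<integral>x. Re (e * h x) * indicator A (X x) \<partial>M) = Re (e * c) * measure \<mu> A"
    if e: "norm e = 1" for e :: complex
  proof -
    define w where "w x = 2 + Re (e * h x)" for x
    have w_meas [measurable]: "w \<in> borel_measurable M"
      unfolding w_def[abs_def] by (intro borel_measurable_add borel_measurable_const measurable_compose[OF _ borel_measurable_Re] borel_measurable_times h)
    have re_le: "\<bar>Re (e * h x)\<bar> \<le> 1" for x
      using abs_Re_le_cmod[of "e * h x"] h_bound[of x] by (simp add: norm_mult e)
    have w1: "1 \<le> w x" "w x \<le> 3" for x
      using re_le[of x] unfolding w_def by linarith+
    have w0: "0 \<le> w x" for x using w1(1)[of x] by simp
    have int_w: "integrable M w"
      by (rule integrable_const_bound[where B = 3]) (use w1 w0 in auto)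
    have int1: "integrable M (\<lambda>x. iexp (a * X x))" for a
      by (rule integrable_const_bound[where B = 1]) (auto simp del: of_real_mult)
    have int2: "integrable M (\<lambda>x. h x * iexp (a * X x))" for a
      by (rule integrable_const_bound[where B = 1])
         (use h_bound in \<open>auto simp: norm_mult simp del: of_real_mult\<close>)
    have int3: "integrable M (\<lambda>x. cnj (h x) * iexp (a * X x))" for a
      by (rule integrable_const_bound[where B = 1])
         (use h_bound in \<open>auto simp: norm_mult simp del: of_real_mult\<close>)
    have conj: "(\<integral>x. cnj (h x) * iexp (a * X x) \<partial>M) = cnj c * char \<mu> a" for a
    proof -
      have "(\<integral>x. cnj (h x) * iexp (a * X x) \<partial>M) = (\<integral>x. cnj (h x * iexp ((-a) * X x)) \<partial>M)"
        by (intro Bochner_Integration.integral_cong) (auto simp: exp_cnj)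
      also have "\<dots> = cnj (c * char \<mu> (-a))"
        by (simp only: Bochner_Integration.integral_cnj char_hX)
      also have "\<dots> = cnj c * cnj (char \<mu> (-a))" by simp
      also have "cnj (char \<mu> (-a)) = char \<mu> a"
        unfolding char_def Bochner_Integration.integral_cnj[symmetric] by (simp add: exp_cnj)
      finally show ?thesis .
    qed
    have weighted_char: "(\<integral>x. complex_of_real (w x) * iexp (a * X x) \<partial>M) = (2 + Re (e * c)) * char \<mu> a" for a
    proof -
      have "(\<integral>x. complex_of_real (w x) * iexp (a * X x) \<partial>M) =
         (\<integral>x. 2 * iexp (a * X x) + (e / 2 * (h x * iexp (a * X x)) + cnj e / 2 * (cnj (h x) * iexp (a * X x))) \<partial>M)"
      proof (intro Bochner_Integration.integral_cong refl)
        fix x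
        have "complex_of_real (Re (e * h x)) = (e * h x + cnj e * cnj (h x)) / 2"
          using complex_add_cnj[of "e * h x"] by simp
        then have "complex_of_real (w x) = 2 + (e * h x + cnj e * cnj (h x)) / 2"
          by (simp add: w_def)
        then show "complex_of_real (w x) * iexp (a * X x) =
          2 * iexp (a * X x) + (e / 2 * (h x * iexp (a * X x)) + cnj e / 2 * (cnj (h x) * iexp (a * X x)))"
          by (simp only:) (simp add: field_simps)
      qed
      also have "\<dots> = 2 * char \<mu> a + (e / 2 * (c * char \<mu> a) + cnj e / 2 * (cnj c * char \<mu> a))"
        using int1[of a] int2[of a] int3[of a]
        by (simp only: Bochner_Integration.integral_add Bochner_Integration.integrable_add
              integrable_mult_right integral_mult_right_zero char_X char_hX conj)
      also have "\<dots> = (2 + (e * c + cnj (e * c)) / 2) * char \<mu> a"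
        by (simp add: field_simps)
      also have "\<dots> = (2 + Re (e * c)) * char \<mu> a"
        by (simp only: complex_add_cnj) simp
      finally show ?thesis .
    qed
    have total: "(\<integral>x. w x \<partial>M) = 2 + Re (e * c)"
    proof -
      have "complex_of_real (\<integral>x. w x \<partial>M) = (\<integral>x. complex_of_real (w x) \<partial>M)"
        by (simp only: integral_complex_of_real)
      also have "\<dots> = complex_of_real (2 + Re (e * c))"
        using weighted_char[of 0] mu.char_zero by simp
      finally show ?thesis by (simp only: of_real_eq_iff)
    qed
    define m where "m = 2 + Re (e * c)"
    have "(1::real) = (\<integral>x. 1 \<partial>M)" by (simp add: prob_space)
    also have "\<dots> \<le> (\<integral>x. w x \<partial>M)"
      by (intro integral_mono int_w) (use w1 in auto)
    finally have m: "0 < m" using total by (simp add: m_def)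
    define Q where "Q = density M (\<lambda>x. ennreal (w x / m))"
    have dens0: "0 \<le> w x / m" for x using w0[of x] m by simp
    have "emeasure Q (space Q) = 1"
    proof -
      have "emeasure Q (space Q) = (\<integral>\<^sup>+x. ennreal (w x / m) \<partial>M)"
        unfolding Q_def by (simp add: emeasure_density cong: nn_integral_cong)
      also have "\<dots> = ennreal (\<integral>x. w x / m \<partial>M)"
        by (intro nn_integral_eq_integral) (use int_w dens0 in auto)
      also have "(\<integral>x. w x / m \<partial>M) = 1"
        using total m by (simp add: m_def)
      finally show ?thesis by simp
    qed
    then interpret Q: prob_space Q by (rule prob_spaceI)
    have XQ: "X \<in> borel_measurable Q" by (simp add: Q_def)
    have rdQ: "real_distribution (distr Q borel X)"
      using XQ by (intro real_distribution.intro Q.prob_space_distr) (auto simp: real_distribution_axioms_def)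
    have "char (distr Q borel X) = char \<mu>"
    proof
      fix a
      have "char (distr Q borel X) a = (\<integral>x. iexp (a * X x) \<partial>Q)"
        unfolding char_def by (subst integral_distr[OF XQ]) auto
      also have "\<dots> = (\<integral>x. (w x / m) *\<^sub>R iexp (a * X x) \<partial>M)"
        unfolding Q_def by (subst integral_density) (use dens0 in auto)
      also have "\<dots> = (\<integral>x. (1 / m) * (complex_of_real (w x) * iexp (a * X x)) \<partial>M)"
        by (intro Bochner_Integration.integral_cong) (auto simp: scaleR_conv_of_real)
      also have "\<dots> = (1 / m) * ((2 + Re (e * c)) * char \<mu> a)"
        by (simp only: integral_mult_right_zero weighted_char)
      also have "\<dots> = char \<mu> a"
      proof -
        have "1 / m * (2 + Re (e * c)) = 1" using m by (simp only: m_def)  simp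
        then have "complex_of_real (1 / m) * complex_of_real (2 + Re (e * c)) = 1"
          by (simp only: flip: of_real_mult) simp
        then show ?thesis by (metis mult.assoc mult_1)
      qed
      finally show "char (distr Q borel X) a = char \<mu> a" .
    qed
    then have Q_mu: "distr Q borel X = \<mu>"
      by (intro Levy_uniqueness rdQ mu)
    have law_X: "distr M borel X = \<mu>"
    proof (intro Levy_uniqueness mu)
      show "real_distribution (distr M borel X)"
        by (intro real_distribution.intro prob_space_distr) (auto simp: real_distribution_axioms_def)
      show "char (distr M borel X) = char \<mu>"
      proof
        fix a have "char (distr M borel X) a = (\<integral>x. iexp (a * X x) \<partial>M)"
          unfolding char_def[of "distr M borel X"] by (subst integral_distr) auto
        then show "char (distr M borel X) a = char \<mu> a" by (simp only: char_X)
      qed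
    qed
    have "m * measure \<mu> A = m * (\<integral>x. indicator A x \<partial>\<mu>)"
      using A by simp
    also have "(\<integral>x. indicator A x \<partial>\<mu>) = (\<integral>x. indicator A (X x) \<partial>Q :: real)"
      using A by (subst Q_mu[symmetric], subst integral_distr[OF XQ]) auto
    also have "\<dots> = (\<integral>x. (w x / m) *\<^sub>R indicator A (X x) \<partial>M)"
      unfolding Q_def using A by (subst integral_density) (use dens0 in auto)
    also have "\<dots> = (\<integral>x. (1 / m) * (w x * indicator A (X x)) \<partial>M)"
      by (intro Bochner_Integration.integral_cong) auto
    also have "m * \<dots> = (\<integral>x. w x * indicator A (X x) \<partial>M)"
      using m by simp
    finally have 1: "(\<integral>x. w x * indicator A (X x) \<partial>M) = m * measure \<mu> A" ..
    have 2: "(\<integral>x. indicator A (X x) \<partial>M) = measure \<mu> A"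
    proof -
      have "(\<integral>x. indicator A (X x) \<partial>M) = (\<integral>x. indicator A x \<partial>distr M borel X :: real)"
        using A by (subst integral_distr) auto
      then show ?thesis using A by (simp add: law_X)
    qed
    have "(\<integral>x. Re (e * h x) * indicator A (X x) \<partial>M) =
          (\<integral>x. w x * indicator A (X x) - 2 * indicator A (X x) \<partial>M)"
      by (intro Bochner_Integration.integral_cong) (auto simp: w_def algebra_simps)
    also have "\<dots> = m * measure \<mu> A - 2 * measure \<mu> A"
    proof (subst Bochner_Integration.integral_diff)
      show "integrable M (\<lambda>x. w x * indicator A (X x))"
        using A by (intro integrable_const_bound[where B = 3]) (use w1 w0 in \<open>auto simp: indicator_def\<close>)
      show "integrable M (\<lambda>x. 2 * indicator A (X x) :: real)"
        using A by (intro integrable_const_bound[where B = 2]) (auto simp: indicator_def)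
    qed (use 1 2 in simp)
    finally show ?thesis by (simp add: m_def algebra_simps)
  qed
  have int: "integrable M (\<lambda>x. h x * indicator A (X x))"
    using A by (intro integrable_const_bound[where B = 1]) (use h_bound in \<open>auto simp: indicator_def\<close>)
  show ?thesis
  proof (rule complex_eqI)
    have "Re (\<integral>x. h x * indicator A (X x) \<partial>M) = (\<integral>x. Re (1 * h x) * indicator A (X x) \<partial>M)"
      unfolding integral_Re[OF int, symmetric]
      by (intro Bochner_Integration.integral_cong) (auto simp: indicator_def)
    then show "Re (\<integral>x. h x * indicator A (X x) \<partial>M) = Re (c * measure \<mu> A)"
      using real_case[of 1] by simp
    have "Im (\<integral>x. h x * indicator A (X x) \<partial>M) = (\<integral>x. Re ((- \<i>) * h x) * indicator A (X x) \<partial>M)"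
      unfolding integral_Im[OF int, symmetric]
      by (intro Bochner_Integration.integral_cong) (auto simp: indicator_def)
    then show "Im (\<integral>x. h x * indicator A (X x) \<partial>M) = Im (c * measure \<mu> A)"
      using real_case[of "- \<i>"] by simp
  qed
qed

text \<open>
  The one-dimensional uniqueness theorem suffices for a joint law: the characters are exchanged for
  indicators one coordinate at a time, while the other coordinates act as a weight.
\<close>

lemma (in prob_space) joint_law_eqI_char:
  fixes X :: "'i \<Rightarrow> 'a \<Rightarrow> real"
  assumes J: "finite J"
    and X [measurable]: "\<And>j. j \<in> J \<Longrightarrow> X j \<in> borel_measurable M"
    and mu: "\<And>j. j \<in> J \<Longrightarrow> real_distribution (\<mu> j)"
    and char_X: "\<And>a. (\<integral>x. iexp (\<Sum>j\<in>J. a j * X j x) \<partial>M) = (\<Prod>j\<in>J. char (\<mu> j) (a j))"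
  shows "distr M (\<Pi>\<^sub>M j\<in>J. borel) (\<lambda>x. \<lambda>j\<in>J. X j x) = (\<Pi>\<^sub>M j\<in>J. \<mu> j)"
proof -
  have mixed: "(\<integral>x. (\<Prod>j\<in>K. indicator (A j) (X j x)) * iexp (\<Sum>j\<in>J - K. a j * X j x) \<partial>M) =
      (\<Prod>j\<in>K. complex_of_real (measure (\<mu> j) (A j))) * (\<Prod>j\<in>J - K. char (\<mu> j) (a j))"
    if K: "K \<subseteq> J" and A: "\<And>j. j \<in> K \<Longrightarrow> A j \<in> sets borel" for K A a
    using finite_subset[OF K J] K A
  proof (induction K arbitrary: a rule: finite_induct)
    case empty
    then show ?case using char_X by simp
  next
    case (insert k K)
    have k: "k \<in> J" "k \<in> J - K" "J - insert k K = (J - K) - {k}" using insert by auto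
    have [measurable]: "j \<in> K \<Longrightarrow> X j \<in> borel_measurable M" "j \<in> K \<Longrightarrow> A j \<in> sets borel" for j
      using insert X by auto
    have [measurable]: "j \<in> J - insert k K \<Longrightarrow> X j \<in> borel_measurable M" for j
      using X by auto
    let ?h = "\<lambda>x. (\<Prod>j\<in>K. indicator (A j) (X j x)) * iexp (\<Sum>j\<in>J - insert k K. a j * X j x)"
    let ?c = "(\<Prod>j\<in>K. complex_of_real (measure (\<mu> j) (A j))) * (\<Prod>j\<in>J - insert k K. char (\<mu> j) (a j))"
    have split: "(\<Sum>j\<in>J - K. (a(k := b)) j * X j x) = b * X k x + (\<Sum>j\<in>J - insert k K. a j * X j x)" for b x
      unfolding k(3) using J k by (subst sum.remove[of "J - K" k]) auto
    have splitc: "(\<Prod>j\<in>J - K. char (\<mu> j) ((a(k := b)) j)) = char (\<mu> k) b * (\<Prod>j\<in>J - insert k K. char (\<mu> j) (a j))" for b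
      unfolding k(3) using J k by (subst prod.remove[of "J - K" k]) auto
    have "(\<integral>x. ?h x * indicator (A k) (X k x) \<partial>M) = ?c * measure (\<mu> k) (A k)"
    proof (rule weighted_law_eqI)
      show "X k \<in> borel_measurable M" using k X by auto
      show "?h \<in> borel_measurable M"
        by measurable
      show "norm (?h x) \<le> 1" for x
      proof -
        have "norm (\<Prod>j\<in>K. indicator (A j) (X j x) :: complex) \<le> (\<Prod>j\<in>K. 1)"
          unfolding prod_norm[symmetric] by (intro prod_mono) (auto simp: indicator_def)
        then show ?thesis by (simp add: norm_mult del: of_real_sum of_real_mult)
      qed
      show "real_distribution (\<mu> k)" using mu k by auto
      show "A k \<in> sets borel" using insert by auto
      fix b
      have "(\<integral>x. iexp (\<Sum>j\<in>J. (if j = k then b else 0) * X j x) \<partial>M) = (\<Prod>j\<in>J. char (\<mu> j) (if j = k then b else 0))"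
        by (rule char_X)
      also have "(\<lambda>x. \<Sum>j\<in>J. (if j = k then b else 0) * X j x) = (\<lambda>x. b * X k x)"
        using J k by (auto simp: fun_eq_iff if_distrib[of "\<lambda>y. y * _"] cong: if_cong)
      also have "(\<Prod>j\<in>J. char (\<mu> j) (if j = k then b else 0)) = (\<Prod>j\<in>J. if j = k then char (\<mu> j) b else 1)"
        using mu by (intro prod.cong) (auto simp: real_distribution.char_zero)
      also have "\<dots> = char (\<mu> k) b" using J k by simp
      finally show "(\<integral>x. iexp (b * X k x) \<partial>M) = char (\<mu> k) b" .
      have "(\<integral>x. ?h x * iexp (b * X k x) \<partial>M) =
        (\<integral>x. (\<Prod>j\<in>K. indicator (A j) (X j x)) * iexp (\<Sum>j\<in>J - K. (a(k := b)) j * X j x) \<partial>M)"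
        unfolding split by (intro Bochner_Integration.integral_cong) (simp_all add: exp_add algebra_simps)
      also have "\<dots> = ?c * char (\<mu> k) b"
        by (subst insert.IH) (use insert.prems splitc in \<open>auto simp: mult_ac\<close>)
      finally show "(\<integral>x. ?h x * iexp (b * X k x) \<partial>M) = ?c * char (\<mu> k) b" .
    qed
    then show ?case
      using insert.hyps by (simp add: mult_ac)
  qed
  have sf: "product_prob_space (\<lambda>j. if j \<in> J then \<mu> j else return borel 0)"
    using mu by (intro product_prob_spaceI)
      (auto intro!: prob_space_return simp: real_distribution_def)
  interpret P: product_prob_space "\<lambda>j. if j \<in> J then \<mu> j else return borel (0::real)" by (rule sf)
  have "distr M (\<Pi>\<^sub>M j\<in>J. borel) (\<lambda>x. \<lambda>j\<in>J. X j x) = PiM J (\<lambda>j. if j \<in> J then \<mu> j else return borel 0)"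
  proof (rule P.PiM_eqI)
    show "finite J" by (rule J)
    have s: "sets (\<mu> j) = sets borel" if "j \<in> J" for j
      using mu[OF that] by (simp add: real_distribution_def real_distribution_axioms_def)
    show "sets (distr M (Pi\<^sub>M J (\<lambda>j. borel)) (\<lambda>x. \<lambda>j\<in>J. X j x)) =
      sets (PiM J (\<lambda>j. if j \<in> J then \<mu> j else return borel (0::real)))"
      using s by (auto intro!: sets_PiM_cong)
    fix A assume A0: "\<And>j. j \<in> J \<Longrightarrow> A j \<in> sets (if j \<in> J then \<mu> j else return borel (0::real))"
    have A: "A j \<in> sets borel" if "j \<in> J" for j using A0[OF that] s that by auto
    have meas: "(\<lambda>x. \<lambda>j\<in>J. X j x) \<in> M \<rightarrow>\<^sub>M (\<Pi>\<^sub>M j\<in>J. borel)"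
      by (intro measurable_restrict) auto
    have PA: "Pi\<^sub>E J A \<in> sets (\<Pi>\<^sub>M j\<in>J. borel)" using A J by (intro sets_PiM_I_finite) auto
    let ?E = "(\<lambda>x. \<lambda>j\<in>J. X j x) -` Pi\<^sub>E J A \<inter> space M"
    have E: "?E \<in> sets M" using measurable_sets[OF meas PA] .
    have "complex_of_real (measure M ?E) = complex_of_real (\<integral>x. indicator ?E x \<partial>M)"
      using E by simp
    also have "\<dots> = (\<integral>x. complex_of_real (indicator ?E x) \<partial>M)"
      by (rule integral_complex_of_real[symmetric])
    also have "\<dots> = (\<integral>x. (\<Prod>j\<in>J. indicator (A j) (X j x)) * iexp (\<Sum>j\<in>J - J. 0 * X j x) \<partial>M)"
    proof (intro Bochner_Integration.integral_cong refl)
      fix x assume x: "x \<in> space M"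
      have "(\<Prod>j\<in>J. indicator (A j) (X j x)) = (if \<forall>j\<in>J. X j x \<in> A j then 1 else 0 :: complex)"
      proof (cases "\<forall>j\<in>J. X j x \<in> A j")
        case False
        then obtain j where "j \<in> J" "indicator (A j) (X j x) = (0 :: complex)"
          by (auto simp: indicator_def)
        then show ?thesis using False J by (subst if_not_P, simp, intro prod_zero) blast+
      qed auto
      then show "complex_of_real (indicator ?E x) =
          (\<Prod>j\<in>J. indicator (A j) (X j x)) * iexp (\<Sum>j\<in>J - J. 0 * X j x)"
        using x by (auto simp: indicator_def PiE_def Pi_def)
    qed
    also have "\<dots> = complex_of_real (\<Prod>j\<in>J. measure (\<mu> j) (A j))"
      using mixed[of J A "\<lambda>_. 0"] A by simp
    finally have "measure M ?E = (\<Prod>j\<in>J. measure (\<mu> j) (A j))"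
      by (simp only: of_real_eq_iff)
    then have "emeasure M ?E = (\<Prod>j\<in>J. emeasure (\<mu> j) (A j))"
      using mu by (simp add: emeasure_eq_measure real_distribution_def
        finite_measure.emeasure_eq_measure[OF prob_space.finite_measure] prod_ennreal)
    then show "emeasure (distr M (\<Pi>\<^sub>M j\<in>J. borel) (\<lambda>x. \<lambda>j\<in>J. X j x)) (Pi\<^sub>E J A) =
       (\<Prod>j\<in>J. emeasure (if j \<in> J then \<mu> j else return borel (0::real)) (A j))"
      by (subst emeasure_distr[OF meas PA]) (auto intro!: prod.cong)
  qed
  also have "\<dots> = PiM J \<mu>"
    by (intro PiM_cong) auto
  finally show ?thesis .
qed

section \<open>The standard complex normal law\<close>

lemma prob_space_half_normal: "prob_space half_normal"
  unfolding half_normal_def by (intro prob_space_normal_density) simp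

lemma real_distribution_half_normal: "real_distribution half_normal"
  using prob_space_half_normal
  by (auto simp: real_distribution_def real_distribution_axioms_def half_normal_def)

lemma sets_half_normal [measurable_cong]: "sets half_normal = sets borel"
  by (simp add: half_normal_def)

lemma char_half_normal: "char half_normal a = complex_of_real (exp (- a\<^sup>2 / 4))"
proof -
  interpret prob_space half_normal by (rule prob_space_half_normal)
  have "distributed half_normal lborel (\<lambda>x. x) (normal_density 0 (sqrt (1/2)))"
    unfolding distributed_def half_normal_def by (auto simp: distr_id2)
  then have "distributed half_normal lborel (\<lambda>x. (x - 0) / sqrt (1/2)) std_normal_density"
    by (subst (asm) normal_standard_normal_convert) auto
  then have std: "distr half_normal lborel (\<lambda>x. x / sqrt (1/2)) = std_normal_distribution"
    by (simp add: distributed_def)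
  have "char half_normal a = (\<integral>x. iexp (a * sqrt (1/2) * (x / sqrt (1/2))) \<partial>half_normal)"
    unfolding char_def by (intro Bochner_Integration.integral_cong) auto
  also have "\<dots> = (\<integral>x. iexp (a * sqrt (1/2) * x) \<partial>distr half_normal lborel (\<lambda>x. x / sqrt (1/2)))"
    by (subst integral_distr) auto
  also have "\<dots> = char std_normal_distribution (a * sqrt (1/2))"
    by (simp add: std char_def)
  also have "\<dots> = complex_of_real (exp (- a\<^sup>2 / 4))"
    by (simp add: char_std_normal_distribution power_mult_distrib)
  finally show ?thesis .
qed

lemma prob_space_std_complex_normal: "prob_space std_complex_normal"
proof -
  interpret H: prob_space half_normal by (rule prob_space_half_normal)
  interpret P: pair_prob_space half_normal half_normal ..
  show ?thesis unfolding std_complex_normal_def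
    by (intro P.prob_space_distr) (auto simp: borel_measurable_complex_iff split_beta)
qed

lemma sets_std_complex_normal [measurable_cong, simp]: "sets std_complex_normal = sets borel"
  by (simp add: std_complex_normal_def)

lemma space_std_complex_normal [simp]: "space std_complex_normal = UNIV"
  by (simp add: std_complex_normal_def)

lemma char_std_complex_normal:
  "(\<integral>z. iexp (Re (cnj c * z)) \<partial>std_complex_normal) = complex_of_real (exp (- (cmod c)\<^sup>2 / 4))"
proof -
  interpret H: prob_space half_normal by (rule prob_space_half_normal)
  interpret P: pair_prob_space half_normal half_normal ..
  have [measurable]: "(\<lambda>(a, b). Complex a b) \<in> half_normal \<Otimes>\<^sub>M half_normal \<rightarrow>\<^sub>M borel"
    by (auto simp: borel_measurable_complex_iff split_beta)
  have "(\<integral>z. iexp (Re (cnj c * z)) \<partial>std_complex_normal) =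
      (\<integral>(x, y). iexp (Re c * x) * iexp (Im c * y) \<partial>(half_normal \<Otimes>\<^sub>M half_normal))"
    unfolding std_complex_normal_def
    by (subst integral_distr)
       (auto intro!: Bochner_Integration.integral_cong simp: exp_add algebra_simps split_beta)
  also have "\<dots> = (\<integral>x. \<integral>y. iexp (Re c * x) * iexp (Im c * y) \<partial>half_normal \<partial>half_normal)"
    by (subst P.integral_fst[symmetric])
       (auto intro!: P.P.integrable_const_bound[where B = 1] simp: norm_mult split_beta simp del: of_real_mult)
  also have "\<dots> = char half_normal (Re c) * char half_normal (Im c)"
    by (simp add: char_def)
  also have "\<dots> = complex_of_real (exp (- (cmod c)\<^sup>2 / 4))"
    by (simp add: char_half_normal cmod_power2 add_divide_distrib diff_divide_distrib
          flip: of_real_mult exp_add)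
  finally show ?thesis .
qed

lemma distr_lborel_Complex:
  "distr (lborel \<Otimes>\<^sub>M lborel) borel (\<lambda>(a, b). Complex a b) = lborel"
proof (rule lborel_eqI[symmetric])
  have m: "(\<lambda>(a, b). Complex a b) \<in> lborel \<Otimes>\<^sub>M lborel \<rightarrow>\<^sub>M borel"
    by (auto simp: borel_measurable_complex_iff split_beta)
  fix l u :: complex
  assume le: "\<And>b. b \<in> Basis \<Longrightarrow> l \<bullet> b \<le> u \<bullet> b"
  then have le': "Re l \<le> Re u" "Im l \<le> Im u"
    using le[of 1] le[of \<i>] by auto
  have "(\<lambda>(a, b). Complex a b) -` box l u \<inter> space (lborel \<Otimes>\<^sub>M lborel) = {Re l<..<Re u} \<times> {Im l<..<Im u}"
    by (auto simp: in_box_complex_iff box_def Basis_complex_def space_pair_measure)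
  then have "emeasure (distr (lborel \<Otimes>\<^sub>M lborel) borel (\<lambda>(a, b). Complex a b)) (box l u) =
      emeasure (lborel \<Otimes>\<^sub>M lborel) ({Re l<..<Re u} \<times> {Im l<..<Im u})"
    by (subst emeasure_distr[OF m]) auto
  also have "\<dots> = ennreal (Re u - Re l) * ennreal (Im u - Im l)"
    using le' by (subst lborel.emeasure_pair_measure_Times) auto
  also have "\<dots> = (\<Prod>b\<in>Basis. (u - l) \<bullet> b)"
    using le' by (simp add: Basis_complex_def ennreal_mult)
  finally show "emeasure (distr (lborel \<Otimes>\<^sub>M lborel) borel (\<lambda>(a, b). Complex a b)) (box l u) =
      (\<Prod>b\<in>Basis. (u - l) \<bullet> b)" .
qed simp

lemma std_complex_normal_density:
  "std_complex_normal = density lborel (\<lambda>z. ennreal (exp (- (cmod z)\<^sup>2) / pi))"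
proof -
  have m: "(\<lambda>(a, b). Complex a b) \<in> lborel \<Otimes>\<^sub>M lborel \<rightarrow>\<^sub>M borel"
    by (auto simp: borel_measurable_complex_iff split_beta)
  let ?f = "normal_density 0 (sqrt (1/2))"
  have "half_normal \<Otimes>\<^sub>M half_normal = density (lborel \<Otimes>\<^sub>M lborel) (\<lambda>(x,y). ennreal (?f x) * ennreal (?f y))"
    unfolding half_normal_def
    by (intro pair_measure_density prob_space_imp_sigma_finite prob_space_normal_density sigma_finite_lborel) auto
  also have "\<dots> = density (lborel \<Otimes>\<^sub>M lborel)
      (\<lambda>p. (\<lambda>z. ennreal (exp (- (cmod z)\<^sup>2) / pi)) ((\<lambda>(a, b). Complex a b) p))"
  proof (intro density_cong AE_I2)
    fix p :: "real \<times> real"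
    have "?f x * ?f y = exp (- (cmod (Complex x y))\<^sup>2) / pi" for x y
      by (simp add: normal_density_def cmod_power2 field_simps flip: exp_add)
    then show "(case p of (x, y) \<Rightarrow> ennreal (?f x) * ennreal (?f y)) =
      (\<lambda>z. ennreal (exp (- (cmod z)\<^sup>2) / pi)) ((\<lambda>(a, b). Complex a b) p)"
      by (auto simp: normal_density_nonneg simp flip: ennreal_mult split: prod.split)
  next
    show "(\<lambda>p. (\<lambda>z. ennreal (exp (- (cmod z)\<^sup>2) / pi)) ((\<lambda>(a, b). Complex a b) p))
        \<in> borel_measurable (lborel \<Otimes>\<^sub>M lborel)"
      by (rule measurable_compose[OF m]) simp
  qed (simp add: split_beta)
  finally have "std_complex_normal = density (distr (lborel \<Otimes>\<^sub>M lborel) borel (\<lambda>(a, b). Complex a b))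
      (\<lambda>z. ennreal (exp (- (cmod z)\<^sup>2) / pi))"
    unfolding std_complex_normal_def by (subst density_distr[OF _ m]) auto
  then show ?thesis by (simp add: distr_lborel_Complex)
qed


abbreviation gauss_tail :: "complex \<Rightarrow> real \<Rightarrow> real" where
  "gauss_tail m t \<equiv> measure std_complex_normal {z. t \<le> cmod (m + z)}"

lemma emeasure_std_complex_normal:
  assumes "A \<in> sets borel"
  shows "emeasure std_complex_normal A = (\<integral>\<^sup>+z. ennreal (exp (- (cmod z)\<^sup>2) / pi) * indicator A z \<partial>lborel)"
  unfolding std_complex_normal_density using assms by (subst emeasure_density) auto

text \<open>
  Since \<open>exp (- \<bar>z\<bar>\<^sup>2)\<close> is the integral of \<open>exp (- u)\<close> over \<open>u \<ge> \<bar>z\<bar>\<^sup>2\<close>, and the annulus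
  \<open>t\<^sup>2 \<le> \<bar>z\<bar>\<^sup>2 \<le> u\<close> has area \<open>\<pi> (u - t\<^sup>2)\<close>, exchanging the order of integration
  leaves the elementary integral of \<open>exp (- u) (u - t\<^sup>2)\<close> over \<open>u \<ge> t\<^sup>2\<close>.
\<close>

lemma gauss_tail_0:
  assumes t: "0 \<le> t"
  shows "gauss_tail 0 t = exp (- t\<^sup>2)"
proof -
  interpret prob_space std_complex_normal by (rule prob_space_std_complex_normal)
  have layer: "ennreal (exp (- r)) = (\<integral>\<^sup>+u. ennreal (exp (- u)) * indicator {r..} u \<partial>lborel)" for r :: real
  proof (subst nn_integral_FTC_atLeast[where F = "\<lambda>u. - exp (- u)" and T = 0])
    show "((\<lambda>u::real. - exp (- u)) \<longlongrightarrow> 0) at_top"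
      by real_asymp
  qed (auto intro!: derivative_eq_intros)
  have scale: "ennreal (exp r / pi) = ennreal (1 / pi) * ennreal (exp r)" for r :: real
    using ennreal_mult[of "1 / pi" "exp r"] by simp
  let ?E = "\<lambda>u z. ennreal (exp (- u) / pi) * indicator {z. t \<le> cmod z \<and> (cmod z)\<^sup>2 \<le> u} z"
  have "emeasure std_complex_normal {z. t \<le> cmod z} =
    (\<integral>\<^sup>+z. ennreal (exp (- (cmod z)\<^sup>2) / pi) * indicator {z. t \<le> cmod z} z \<partial>lborel)"
    by (intro emeasure_std_complex_normal) measurable
  also have "\<dots> = (\<integral>\<^sup>+z. (\<integral>\<^sup>+u. ?E u z \<partial>lborel) \<partial>lborel)"
  proof (intro nn_integral_cong)
    fix z :: complex
    have "ennreal (exp (- (cmod z)\<^sup>2) / pi) * indicator {z. t \<le> cmod z} z =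
       (ennreal (1 / pi) * indicator {z. t \<le> cmod z} z) * ennreal (exp (- (cmod z)\<^sup>2))"
      by (simp only: scale mult_ac)
    also have "\<dots> = (\<integral>\<^sup>+u. (ennreal (1 / pi) * indicator {z. t \<le> cmod z} z) * (ennreal (exp (- u)) * indicator {(cmod z)\<^sup>2..} u) \<partial>lborel)"
      by (subst layer, subst nn_integral_cmult) auto
    also have "\<dots> = (\<integral>\<^sup>+u. ?E u z \<partial>lborel)"
      by (intro nn_integral_cong) (simp add: scale indicator_def)
    finally show "ennreal (exp (- (cmod z)\<^sup>2) / pi) * indicator {z. t \<le> cmod z} z = (\<integral>\<^sup>+u. ?E u z \<partial>lborel)" .
  qed
  also have "\<dots> = (\<integral>\<^sup>+u. (\<integral>\<^sup>+z. ?E u z \<partial>lborel) \<partial>lborel)"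
    by (rule lborel_pair.Fubini') measurable
  also have "\<dots> = (\<integral>\<^sup>+u. ennreal (exp (- u) * (u - t\<^sup>2)) * indicator {t\<^sup>2..} u \<partial>lborel)"
  proof (intro nn_integral_cong)
    fix u :: real
    have "(\<integral>\<^sup>+z. ?E u z \<partial>lborel) = ennreal (exp (- u) / pi) * emeasure lborel {z::complex. t \<le> cmod z \<and> (cmod z)\<^sup>2 \<le> u}"
      by (subst nn_integral_cmult_indicator) auto
    also have "\<dots> = ennreal (exp (- u) * (u - t\<^sup>2)) * indicator {t\<^sup>2..} u"
    proof (cases "t\<^sup>2 \<le> u")
      case True
      then have u: "0 \<le> u" using zero_le_power2[of t] by linarith
      have sq: "(cmod z)\<^sup>2 \<le> u \<longleftrightarrow> cmod z \<le> sqrt u" for z :: complex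
        using real_sqrt_le_iff[of "(cmod z)\<^sup>2" u] by simp
      have eq: "{z::complex. t \<le> cmod z \<and> (cmod z)\<^sup>2 \<le> u} = cball 0 (sqrt u) - ball 0 t"
        unfolding sq by (auto simp: not_less)
      have "t \<le> sqrt u" using True t real_le_rsqrt by blast
      then have sub: "ball (0::complex) t \<subseteq> cball 0 (sqrt u)" by auto
      have "emeasure lborel (cball (0::complex) (sqrt u) - ball 0 t) =
         emeasure lborel (cball (0::complex) (sqrt u)) - emeasure lborel (ball (0::complex) t)"
        by (intro emeasure_Diff) (use sub t in \<open>auto simp: emeasure_ball\<close>)
      also have "\<dots> = ennreal (pi * u) - ennreal (pi * t\<^sup>2)"
        using t u by (simp add: emeasure_ball emeasure_cball unit_ball_vol_2)
      also have "\<dots> = ennreal (pi * (u - t\<^sup>2))"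
        by (simp add: ennreal_minus right_diff_distrib)
      finally have "ennreal (exp (- u) / pi) * emeasure lborel {z::complex. t \<le> cmod z \<and> (cmod z)\<^sup>2 \<le> u} =
          ennreal (exp (- u) / pi * (pi * (u - t\<^sup>2)))"
        using True unfolding eq by (subst ennreal_mult) auto
      then show ?thesis using True by simp
    next
      case False
      then have "{z::complex. t \<le> cmod z \<and> (cmod z)\<^sup>2 \<le> u} = {}"
        by (auto dest!: power_mono[OF _ t, where n = 2])
      then have "emeasure lborel {z::complex. t \<le> cmod z \<and> (cmod z)\<^sup>2 \<le> u} = 0"
        by (simp only: emeasure_empty)
      then show ?thesis using False by simp
    qed
    finally show "(\<integral>\<^sup>+z. ?E u z \<partial>lborel) = ennreal (exp (- u) * (u - t\<^sup>2)) * indicator {t\<^sup>2..} u" .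
  qed
  also have "\<dots> = ennreal (0 - (- (t\<^sup>2 - t\<^sup>2 + 1) * exp (- (t\<^sup>2))))"
  proof (rule nn_integral_FTC_atLeast[where F = "\<lambda>u. - (u - t\<^sup>2 + 1) * exp (- u)"])
    show "((\<lambda>u. - (u - t\<^sup>2 + 1) * exp (- u)) \<longlongrightarrow> 0) at_top"
      by real_asymp
    show "((\<lambda>u. - (u - t\<^sup>2 + 1) * exp (- u)) has_real_derivative exp (- u) * (u - t\<^sup>2)) (at u)" for u
      by (auto intro!: derivative_eq_intros simp: algebra_simps)
  qed auto
  finally show ?thesis by (simp add: emeasure_eq_measure)
qed


text \<open>
  A planar case of Anderson's inequality. The density is at least \<open>k = exp (- t\<^sup>2) / \<pi>\<close> inside the disc of radius \<open>t\<close> around 0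
  and at most \<open>k\<close> outside, and a shifted disc has the same area; so shifting the disc cannot gain mass.
\<close>

lemma gauss_tail_ge_central:
  assumes t: "0 \<le> t"
  shows "exp (- t\<^sup>2) \<le> gauss_tail m t"
proof -
  interpret prob_space std_complex_normal by (rule prob_space_std_complex_normal)
  define f where "f z = exp (- (cmod z)\<^sup>2) / pi" for z
  define k where "k = exp (- t\<^sup>2) / pi"
  have f0: "0 \<le> f z" and k0: "0 \<le> k" for z by (auto simp: f_def k_def)
  have [measurable]: "f \<in> borel_measurable borel" unfolding f_def[abs_def] by measurable
  have em: "emeasure std_complex_normal A = (\<integral>\<^sup>+z. ennreal (f z) * indicator A z \<partial>lborel)"
    if "A \<in> sets borel" for A
    unfolding f_def using that by (rule emeasure_std_complex_normal)
  let ?B = "ball (0::complex) t" and ?B' = "ball (- m) t"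
  have swap: "(\<integral>\<^sup>+z. ennreal (f z * indicator A z + k * indicator B z) \<partial>lborel) =
      emeasure std_complex_normal A + ennreal k * emeasure lborel B"
    if [measurable]: "A \<in> sets borel" "B \<in> sets borel" for A B :: "complex set"
  proof -
    have "(\<integral>\<^sup>+z. ennreal (f z * indicator A z + k * indicator B z) \<partial>lborel) =
        (\<integral>\<^sup>+z. ennreal (f z) * indicator A z + ennreal k * indicator B z \<partial>lborel)"
      using f0 k0 by (intro nn_integral_cong) (simp add: indicator_def)
    also have "\<dots> = (\<integral>\<^sup>+z. ennreal (f z) * indicator A z \<partial>lborel) + (\<integral>\<^sup>+z. ennreal k * indicator B z \<partial>lborel)"
      by (rule nn_integral_add) measurable
    finally show ?thesis by (simp add: em nn_integral_cmult_indicator)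
  qed
  have "emeasure std_complex_normal ?B' + ennreal k * emeasure lborel ?B =
      (\<integral>\<^sup>+z. ennreal (f z * indicator ?B' z + k * indicator ?B z) \<partial>lborel)"
    by (simp add: swap)
  also have "\<dots> \<le> (\<integral>\<^sup>+z. ennreal (f z * indicator ?B z + k * indicator ?B' z) \<partial>lborel)"
  proof (intro nn_integral_mono ennreal_leI)
    fix z :: complex
    have "k \<le> f z" if "cmod z < t"
      using that t by (auto simp: k_def f_def divide_right_mono intro!: power_mono)
    moreover have "f z \<le> k" if "\<not> cmod z < t"
      using that t by (auto simp: k_def f_def divide_right_mono intro!: power_mono)
    ultimately show "f z * indicator ?B' z + k * indicator ?B z \<le> f z * indicator ?B z + k * indicator ?B' z"
      by (auto simp: indicator_def)
  qed
  also have "\<dots> = emeasure std_complex_normal ?B + ennreal k * emeasure lborel ?B'"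
    by (simp add: swap)
  finally have "emeasure std_complex_normal ?B' \<le> emeasure std_complex_normal ?B"
    using t k0 by (simp add: emeasure_ball emeasure_eq_measure flip: ennreal_mult' ennreal_plus)
  then have le: "measure std_complex_normal ?B' \<le> measure std_complex_normal ?B"
    by (simp add: emeasure_eq_measure)
  have compl: "gauss_tail c t = 1 - measure std_complex_normal (ball (- c) t)" for c
  proof -
    have "{z. t \<le> cmod (c + z)} = space std_complex_normal - ball (- c) t"
      by (auto simp: dist_norm norm_minus_commute[of "- c"] add.commute)
    moreover have "prob (space std_complex_normal - ball (- c) t) = 1 - prob (ball (- c) t)"
      by (rule prob_compl) simp
    ultimately show ?thesis by simp
  qed
  show ?thesis
    using le compl[of 0] compl[of m] gauss_tail_0[OF t] by simp
qed


text \<open>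
  The unit disc around the point \<open>w\<close> of modulus \<open>x + 1\<close> in the direction of \<open>m\<close> lies in the event; it
  has area \<open>\<pi>\<close>, and the density there is at least \<open>exp (- (x + 2)\<^sup>2) / \<pi>\<close>.
\<close>

lemma gauss_tail_ge:
  assumes "t \<le> cmod m + x" "0 \<le> x"
  shows "exp (- (x + 2)\<^sup>2) \<le> gauss_tail m t"
proof -
  interpret prob_space std_complex_normal by (rule prob_space_std_complex_normal)
  define e where "e = (if m = 0 then 1 else m / of_real (cmod m))"
  have e: "cmod e = 1" "m = of_real (cmod m) * e"
    by (auto simp: e_def norm_divide)
  define w where "w = of_real (x + 1) * e"
  have cw: "cmod w = x + 1" using assms e by (simp add: w_def norm_mult del: of_real_add)
  have "m + w = of_real (cmod m + x + 1) * e"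
    by (subst e(2)) (simp add: w_def algebra_simps)
  then have cmw: "cmod (m + w) = cmod m + x + 1"
    using assms e(1) norm_ge_zero[of m] by (simp add: norm_mult del: of_real_add)
  have "ennreal (exp (- (x + 2)\<^sup>2)) = (\<integral>\<^sup>+z. ennreal (exp (- (x + 2)\<^sup>2) / pi) * indicator (cball w 1) z \<partial>lborel)"
    by (subst nn_integral_cmult_indicator) (auto simp: emeasure_cball unit_ball_vol_2 simp flip: ennreal_mult')
  also have "\<dots> \<le> (\<integral>\<^sup>+z. ennreal (exp (- (cmod z)\<^sup>2) / pi) * indicator (cball w 1) z \<partial>lborel)"
  proof (intro nn_integral_mono)
    fix z
    have "exp (- (x + 2)\<^sup>2) / pi \<le> exp (- (cmod z)\<^sup>2) / pi" if "z \<in> cball w 1"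
    proof -
      have "cmod z \<le> cmod w + cmod (z - w)" using norm_triangle_ineq[of w "z - w"] by simp
      also have "\<dots> \<le> x + 2" using that cw by (simp add: dist_norm norm_minus_commute)
      finally show ?thesis by (intro divide_right_mono) (auto intro!: power_mono)
    qed
    then show "ennreal (exp (- (x + 2)\<^sup>2) / pi) * indicator (cball w 1) z \<le>
        ennreal (exp (- (cmod z)\<^sup>2) / pi) * indicator (cball w 1) z"
      by (auto simp: indicator_def ennreal_leI)
  qed
  also have "\<dots> = emeasure std_complex_normal (cball w 1)"
    by (intro emeasure_std_complex_normal[symmetric]) auto
  also have "\<dots> \<le> emeasure std_complex_normal {z. t \<le> cmod (m + z)}"
  proof (intro emeasure_mono subsetI CollectI)
    fix z assume "z \<in> cball w 1"
    then have "cmod (z - w) \<le> 1" by (simp add: dist_norm norm_minus_commute)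
    moreover have "cmod (m + w) \<le> cmod (m + z) + cmod (z - w)"
      using norm_triangle_ineq4[of "m + z" "z - w"] by (simp add: algebra_simps)
    ultimately show "t \<le> cmod (m + z)" using cmw assms by linarith
  qed measurable
  finally show ?thesis by (simp add: emeasure_eq_measure)
qed

section \<open>Orthonormal transforms of the noise\<close>

lemma prob_space_noise: "prob_space (noise N)"
  unfolding noise_def by (intro prob_space_PiM prob_space_std_complex_normal)

lemma sets_noise [measurable_cong]: "sets (noise N) = sets (\<Pi>\<^sub>M t\<in>{1..N}. borel)"
  unfolding noise_def by (intro sets_PiM_cong) auto

lemma char_PiM_std_complex_normal:
  fixes c :: "'i \<Rightarrow> complex"
  assumes K: "finite K"
  shows "(\<integral>z. iexp (Re (\<Sum>k\<in>K. cnj (c k) * z k)) \<partial>(\<Pi>\<^sub>M k\<in>K. std_complex_normal)) =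
    complex_of_real (exp (- (\<Sum>k\<in>K. (cmod (c k))\<^sup>2) / 4))"
proof -
  interpret S: prob_space std_complex_normal by (rule prob_space_std_complex_normal)
  interpret P: product_prob_space "\<lambda>_::'i. std_complex_normal" by unfold_locales
  have "(\<integral>z. iexp (Re (\<Sum>k\<in>K. cnj (c k) * z k)) \<partial>(\<Pi>\<^sub>M k\<in>K. std_complex_normal)) =
    (\<integral>z. (\<Prod>k\<in>K. iexp (Re (cnj (c k) * z k))) \<partial>(\<Pi>\<^sub>M k\<in>K. std_complex_normal))"
    using K by (intro Bochner_Integration.integral_cong)
      (simp_all only: Re_sum of_real_sum sum_distrib_left exp_sum)
  also have "\<dots> = (\<Prod>k\<in>K. (\<integral>z. iexp (Re (cnj (c k) * z)) \<partial>std_complex_normal))"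
  proof (rule P.product_integral_prod[OF K])
    show "integrable std_complex_normal (\<lambda>z. iexp (Re (cnj (c k) * z)))" for k
      by (rule S.integrable_const_bound[where B = 1]) (auto simp del: of_real_mult)
  qed
  also have "\<dots> = complex_of_real (\<Prod>k\<in>K. exp (- (cmod (c k))\<^sup>2 / 4))"
    by (simp only: char_std_complex_normal of_real_prod)
  also have "(\<Prod>k\<in>K. exp (- (cmod (c k))\<^sup>2 / 4)) = exp (- (\<Sum>k\<in>K. (cmod (c k))\<^sup>2) / 4)"
    using K by (simp add: sum_negf sum_divide_distrib flip: exp_sum)
  finally show ?thesis .
qed

text \<open>
  Passing to real and imaginary parts reduces this to \<open>joint_law_eqI_char\<close>. The law of the real
  coordinates is computed for the given family and also for the coordinates of the product measure,
  which spares a separate proof that pairs of independent real coordinates are independent.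
\<close>

lemma (in prob_space) joint_law_std_complex_normalI:
  fixes V :: "'i \<Rightarrow> 'a \<Rightarrow> complex"
  assumes K: "finite K"
    and V: "\<And>k. k \<in> K \<Longrightarrow> V k \<in> borel_measurable M"
    and char_V: "\<And>w. (\<integral>x. iexp (Re (\<Sum>k\<in>K. cnj (w k) * V k x)) \<partial>M) =
       complex_of_real (exp (- (\<Sum>k\<in>K. (cmod (w k))\<^sup>2) / 4))"
  shows "distr M (\<Pi>\<^sub>M k\<in>K. borel) (\<lambda>x. \<lambda>k\<in>K. V k x) = (\<Pi>\<^sub>M k\<in>K. std_complex_normal)"
proof -
  let ?J = "K \<times> (UNIV :: bool set)"
  let ?R = "\<Pi>\<^sub>M j\<in>?J. (borel :: real measure)"
  define G :: "('i \<times> bool \<Rightarrow> real) \<Rightarrow> 'i \<Rightarrow> complex"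
    where "G f = (\<lambda>k\<in>K. Complex (f (k, True)) (f (k, False)))" for f
  define part :: "complex \<Rightarrow> bool \<Rightarrow> real" where "part z b = (if b then Re z else Im z)" for z b
  have part_meas: "(\<lambda>x. part x b) \<in> borel_measurable borel" for b
    by (cases b) (auto simp: part_def)
  have G: "G \<in> ?R \<rightarrow>\<^sub>M (\<Pi>\<^sub>M k\<in>K. borel)"
    unfolding G_def by (intro measurable_restrict) (auto simp: borel_measurable_complex_iff)
  \<comment> \<open>The law of the real coordinates is determined, hence so is the law of the complex ones.\<close>
  have law: "distr M' (\<Pi>\<^sub>M k\<in>K. borel) (\<lambda>x. \<lambda>k\<in>K. W k x) =
      distr (\<Pi>\<^sub>M j\<in>?J. half_normal) (\<Pi>\<^sub>M k\<in>K. borel) G"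
    if M': "prob_space M'" and W: "\<And>k. k \<in> K \<Longrightarrow> W k \<in> borel_measurable M'"
    and char_W: "\<And>w. (\<integral>x. iexp (Re (\<Sum>k\<in>K. cnj (w k) * W k x)) \<partial>M') =
       complex_of_real (exp (- (\<Sum>k\<in>K. (cmod (w k))\<^sup>2) / 4))"
    for M' :: "'c measure" and W :: "'i \<Rightarrow> 'c \<Rightarrow> complex"
  proof -
    interpret M': prob_space M' by (rule M')
    define X where "X j x = part (W (fst j) x) (snd j)" for j x
    have X: "X j \<in> borel_measurable M'" if "j \<in> ?J" for j
      unfolding X_def[abs_def] by (rule measurable_compose[OF W part_meas]) (use that in auto)
    have "distr M' ?R (\<lambda>x. \<lambda>j\<in>?J. X j x) = (\<Pi>\<^sub>M j\<in>?J. half_normal)"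
    proof (rule M'.joint_law_eqI_char)
      show "finite ?J" using K by simp
      show "X j \<in> borel_measurable M'" if "j \<in> ?J" for j by (rule X[OF that])
      show "real_distribution half_normal" by (rule real_distribution_half_normal)
      fix a :: "'i \<times> bool \<Rightarrow> real"
      let ?w = "\<lambda>k. Complex (a (k, True)) (a (k, False))"
      have "(\<Sum>j\<in>?J. a j * X j x) = Re (\<Sum>k\<in>K. cnj (?w k) * W k x)" for x
        unfolding sum.cartesian_product[symmetric] Re_sum
          sum.cartesian_product[of "\<lambda>k b. a (k, b) * X (k, b) x", simplified, symmetric]
        by (simp add: UNIV_bool X_def part_def add.commute)
      then have "(\<integral>x. iexp (\<Sum>j\<in>?J. a j * X j x) \<partial>M') = complex_of_real (exp (- (\<Sum>k\<in>K. (cmod (?w k))\<^sup>2) / 4))"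
        by (simp only: char_W)
      also have "(\<Sum>k\<in>K. (cmod (?w k))\<^sup>2) = (\<Sum>j\<in>?J. (a j)\<^sup>2)"
        unfolding sum.cartesian_product[of "\<lambda>k b. (a (k, b))\<^sup>2", simplified, symmetric]
        by (simp add: UNIV_bool cmod_power2 add.commute)
      also have "exp (- (\<Sum>j\<in>?J. (a j)\<^sup>2) / 4) = (\<Prod>j\<in>?J. exp (- (a j)\<^sup>2 / 4))"
        using K by (simp add: sum_negf sum_divide_distrib flip: exp_sum)
      also have "complex_of_real \<dots> = (\<Prod>j\<in>?J. char half_normal (a j))"
        by (simp only: char_half_normal of_real_prod)
      finally show "(\<integral>x. iexp (\<Sum>j\<in>?J. a j * X j x) \<partial>M') = (\<Prod>j\<in>?J. char half_normal (a j))" .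
    qed
    then have "distr (\<Pi>\<^sub>M j\<in>?J. half_normal) (\<Pi>\<^sub>M k\<in>K. borel) G =
        distr (distr M' ?R (\<lambda>x. \<lambda>j\<in>?J. X j x)) (\<Pi>\<^sub>M k\<in>K. borel) G"
      by simp
    also have "\<dots> = distr M' (\<Pi>\<^sub>M k\<in>K. borel) (G \<circ> (\<lambda>x. \<lambda>j\<in>?J. X j x))"
      by (rule distr_distr[OF G]) (intro measurable_restrict X)
    also have "G \<circ> (\<lambda>x. \<lambda>j\<in>?J. X j x) = (\<lambda>x. \<lambda>k\<in>K. W k x)"
      by (auto simp: G_def X_def part_def fun_eq_iff restrict_def complex_eq_iff)
    finally show ?thesis ..
  qed
  let ?S = "\<Pi>\<^sub>M k\<in>K. std_complex_normal"
  have sets_S: "sets ?S = sets (\<Pi>\<^sub>M k\<in>K. borel)"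
    by (intro sets_PiM_cong) auto
  have "distr M (\<Pi>\<^sub>M k\<in>K. borel) (\<lambda>x. \<lambda>k\<in>K. V k x) =
      distr (\<Pi>\<^sub>M j\<in>?J. half_normal) (\<Pi>\<^sub>M k\<in>K. borel) G"
    by (rule law) (use V char_V prob_space_axioms in auto)
  also have "\<dots> = distr ?S (\<Pi>\<^sub>M k\<in>K. borel) (\<lambda>x. \<lambda>k\<in>K. x k)"
  proof (rule law[symmetric])
    show "prob_space ?S" by (intro prob_space_PiM prob_space_std_complex_normal)
    show "(\<lambda>x. x k) \<in> borel_measurable ?S" if "k \<in> K" for k
      by (subst measurable_cong_sets[OF sets_S refl]) (rule measurable_component_singleton[OF that])
  qed (rule char_PiM_std_complex_normal[OF K])
  also have "\<dots> = distr ?S ?S (\<lambda>x. x)"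
    by (rule distr_cong[OF refl]) (auto simp: sets_S[symmetric] space_PiM PiE_def extensional_restrict)
  finally show ?thesis by simp
qed

text \<open>
  Rotation invariance of the Gaussian law: a linear combination of the new variables with coefficients \<open>w\<close> is one of the
  old variables with coefficients \<open>c\<close>, where \<open>(\<Sum>t. \<bar>c t\<bar>\<^sup>2) = (\<Sum>k. \<bar>w k\<bar>\<^sup>2)\<close> by orthonormality, and the
  characteristic function depends on this sum only.
\<close>

lemma law_orthonormal_noise:
  fixes u :: "'i \<Rightarrow> nat \<Rightarrow> complex"
  assumes K: "finite K"
    and u: "\<And>k k'. k \<in> K \<Longrightarrow> k' \<in> K \<Longrightarrow> (\<Sum>t=1..N. u k t * cnj (u k' t)) = of_bool (k = k')"
  shows "distr (noise N) (\<Pi>\<^sub>M k\<in>K. borel) (\<lambda>z. \<lambda>k\<in>K. \<Sum>t=1..N. u k t * z t) =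
    (\<Pi>\<^sub>M k\<in>K. std_complex_normal)"
proof -
  interpret prob_space "noise N" by (rule prob_space_noise)
  show ?thesis
  proof (rule joint_law_std_complex_normalI[OF K])
    show "(\<lambda>z. \<Sum>t=1..N. u k t * z t) \<in> borel_measurable (noise N)" for k
      by measurable
    fix w :: "'i \<Rightarrow> complex"
    define c where "c t = (\<Sum>k\<in>K. w k * cnj (u k t))" for t
    have "(\<Sum>k\<in>K. cnj (w k) * (\<Sum>t=1..N. u k t * z t)) = (\<Sum>t=1..N. cnj (c t) * z t)" for z
      unfolding c_def by (simp add: sum_distrib_left sum_distrib_right mult_ac) (rule sum.swap)
    then have "expectation (\<lambda>z. iexp (Re (\<Sum>k\<in>K. cnj (w k) * (\<Sum>t=1..N. u k t * z t)))) =
       complex_of_real (exp (- (\<Sum>t=1..N. (cmod (c t))\<^sup>2) / 4))"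
      using char_PiM_std_complex_normal[of "{1..N}" c] by (simp add: noise_def)
    also have "(\<Sum>t=1..N. (cmod (c t))\<^sup>2) = (\<Sum>k\<in>K. (cmod (w k))\<^sup>2)"
    proof -
      have "complex_of_real (\<Sum>t=1..N. (cmod (c t))\<^sup>2) = (\<Sum>t=1..N. c t * cnj (c t))"
        by (simp only: of_real_sum complex_norm_square)
      also have "\<dots> = (\<Sum>t=1..N. \<Sum>k\<in>K. \<Sum>k'\<in>K. w k * cnj (w k') * (u k' t * cnj (u k t)))"
        unfolding c_def by (simp add: sum_product mult_ac)
      also have "\<dots> = (\<Sum>k\<in>K. \<Sum>k'\<in>K. w k * cnj (w k') * (\<Sum>t=1..N. u k' t * cnj (u k t)))"
        unfolding sum_distrib_left by (subst sum.swap, intro sum.cong refl, rule sum.swap)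
      also have "\<dots> = (\<Sum>k\<in>K. \<Sum>k'\<in>K. w k * cnj (w k') * of_bool (k' = k))"
        using u by (intro sum.cong refl) simp
      also have "\<dots> = (\<Sum>k\<in>K. w k * cnj (w k))"
        using K by (intro sum.cong refl) (simp add: of_bool_def if_distrib cong: if_cong)
      also have "\<dots> = complex_of_real (\<Sum>k\<in>K. (cmod (w k))\<^sup>2)"
        by (simp only: of_real_sum complex_norm_square)
      finally show ?thesis by (simp only: of_real_eq_iff)
    qed
    finally show "expectation (\<lambda>z. iexp (Re (\<Sum>k\<in>K. cnj (w k) * (\<Sum>t=1..N. u k t * z t)))) =
       complex_of_real (exp (- (\<Sum>k\<in>K. (cmod (w k))\<^sup>2) / 4))" .
  qed
qed

section \<open>Counts of independent events\<close>

text \<open>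
  Chernoff's bound; the exponent \<open>lam\<close> is left free so that it can be adapted to the expected count.
\<close>

lemma (in product_prob_space) count_upper_tail:
  fixes S :: "'i \<Rightarrow> 'a set" and lam u :: real
  assumes I: "finite I" and S: "\<And>i. i \<in> I \<Longrightarrow> S i \<in> sets (M i)" and lam: "0 \<le> lam"
  shows "measure (PiM I M) {x \<in> space (PiM I M). u \<le> (\<Sum>i\<in>I. indicator (S i) (x i))}
    \<le> exp ((exp lam - 1) * (\<Sum>i\<in>I. measure (M i) (S i)) - lam * u)"
proof -
  interpret P: prob_space "PiM I M" by (intro prob_space_PiM prob_space)
  have [measurable]: "(\<lambda>x. indicator (S i) (x i) :: real) \<in> borel_measurable (PiM I M)" if "i \<in> I" for i
    using S[OF that] that by measurable
  have [measurable]: "(\<lambda>x. \<Sum>i\<in>I. indicator (S i) (x i) :: real) \<in> borel_measurable (PiM I M)"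
    by measurable
  have int_ind: "integrable (M i) (indicator (S i) :: _ \<Rightarrow> real)" if "i \<in> I" for i
    using S[OF that] by (intro integrable_real_indicator) (auto simp: M.emeasure_eq_measure)
  let ?g = "\<lambda>x. exp (lam * (\<Sum>i\<in>I. indicator (S i) (x i)))"
  have int: "integrable (PiM I M) ?g"
  proof (rule P.integrable_const_bound[where B = "exp (lam * card I)"])
    have "(\<Sum>i\<in>I. indicator (S i) (x i)) \<le> real (card I)" for x
      using sum_bounded_above[of I "\<lambda>i. indicator (S i) (x i)" "1::real"] by (simp add: indicator_def)
    then show "AE x in PiM I M. norm (?g x) \<le> exp (lam * card I)"
      using lam by (auto intro!: mult_left_mono)
  qed measurable
  have "P.expectation ?g = P.expectation (\<lambda>x. \<Prod>i\<in>I. exp (lam * indicator (S i) (x i)))"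
    using I by (simp only: sum_distrib_left exp_sum)
  also have "\<dots> = (\<Prod>i\<in>I. \<integral>x. exp (lam * indicator (S i) x) \<partial>M i)"
  proof (rule product_integral_prod[OF I])
    fix i assume i: "i \<in> I"
    show "integrable (M i) (\<lambda>x. exp (lam * indicator (S i) x))"
      using S[OF i] lam
      by (intro M.integrable_const_bound[where B = "exp lam"]) (auto simp: indicator_def)
  qed
  also have "\<dots> = (\<Prod>i\<in>I. 1 + measure (M i) (S i) * (exp lam - 1))"
  proof (intro prod.cong refl)
    fix i assume i: "i \<in> I"
    have "(\<integral>x. exp (lam * indicator (S i) x) \<partial>M i) = (\<integral>x. 1 + indicator (S i) x * (exp lam - 1) \<partial>M i)"
      by (intro Bochner_Integration.integral_cong) (auto simp: indicator_def)
    also have "\<dots> = 1 + measure (M i) (S i) * (exp lam - 1)"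
      using S[OF i] int_ind[OF i] by (subst Bochner_Integration.integral_add) (auto simp: M.prob_space)
    finally show "(\<integral>x. exp (lam * indicator (S i) x) \<partial>M i) = 1 + measure (M i) (S i) * (exp lam - 1)" .
  qed
  also have "\<dots> \<le> (\<Prod>i\<in>I. exp (measure (M i) (S i) * (exp lam - 1)))"
    using lam by (intro prod_mono conjI exp_ge_add_one_self add_nonneg_nonneg mult_nonneg_nonneg) auto
  also have "\<dots> = exp ((exp lam - 1) * (\<Sum>i\<in>I. measure (M i) (S i)))"
    using I by (simp add: sum_distrib_left mult.commute flip: exp_sum)
  finally have mgf: "P.expectation ?g \<le> exp ((exp lam - 1) * (\<Sum>i\<in>I. measure (M i) (S i)))" .
  have "measure (PiM I M) {x \<in> space (PiM I M). u \<le> (\<Sum>i\<in>I. indicator (S i) (x i))} \<le>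
      measure (PiM I M) {x \<in> space (PiM I M). exp (lam * u) \<le> ?g x}"
    using lam by (intro P.finite_measure_mono) (auto intro: mult_left_mono)
  also have "\<dots> \<le> P.expectation ?g / exp (lam * u)"
    by (rule integral_Markov_inequality_measure[OF int, of "{}"]) auto
  also have "\<dots> \<le> exp ((exp lam - 1) * (\<Sum>i\<in>I. measure (M i) (S i))) / exp (lam * u)"
    by (intro divide_right_mono mgf) auto
  finally show ?thesis by (simp add: exp_diff)
qed

text \<open>
  Cross terms vanish by independence, and an indicator of probability \<open>p\<close> has variance \<open>p - p\<^sup>2 \<le> p\<close>.
\<close>

lemma (in product_prob_space) count_variance_le:
  fixes S :: "'i \<Rightarrow> 'a set"
  assumes I: "finite I" and S: "\<And>i. i \<in> I \<Longrightarrow> S i \<in> sets (M i)"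
  shows "(\<integral>x. (\<Sum>i\<in>I. indicator (S i) (x i) - measure (M i) (S i))\<^sup>2 \<partial>PiM I M)
    \<le> (\<Sum>i\<in>I. measure (M i) (S i))"
proof -
  interpret P: prob_space "PiM I M" by (intro prob_space_PiM prob_space)
  define p where "p i = measure (M i) (S i)" for i
  have p: "0 \<le> p i" "p i \<le> 1" if "i \<in> I" for i
    unfolding p_def using prob_space.prob_le_1[OF prob_space] by auto
  have int_ind: "integrable (M i) (indicator (S i) :: _ \<Rightarrow> real)" if "i \<in> I" for i
    using S[OF that] by (intro integrable_real_indicator) (auto simp: M.emeasure_eq_measure)
  define d where "d i a = indicator (S i) a - p i" for i a
  have d1: "\<bar>d i a\<bar> \<le> 1" if "i \<in> I" for i a using p[OF that] by (auto simp: d_def indicator_def)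
  have d_meas: "d i \<in> borel_measurable (M i)" if "i \<in> I" for i
    unfolding d_def[abs_def] using S[OF that] by measurable
  have [measurable]: "(\<lambda>x. d i (x i)) \<in> borel_measurable (PiM I M)" if "i \<in> I" for i
    using d_meas[OF that] that by measurable
  have d_int: "integrable (M i) (d i)" if "i \<in> I" for i
    using int_ind[OF that] by (auto simp: d_def[abs_def])
  have d_mean: "(\<integral>a. d i a \<partial>M i) = 0" if "i \<in> I" for i
  proof -
    show ?thesis using S[OF that] int_ind[OF that]
      unfolding d_def by (subst Bochner_Integration.integral_diff) (auto simp: p_def M.prob_space)
  qed
  have cross: "P.expectation (\<lambda>x. d i (x i) * d j (x j)) \<le> (if i = j then p i else 0)"
    if ij: "i \<in> I" "j \<in> I" for i j
  proof (cases "i = j")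
    case True
    have "P.expectation (\<lambda>x. d i (x i) * d i (x i)) = (\<integral>a. d i a * d i a \<partial>distr (PiM I M) (M i) (\<lambda>x. x i))"
      using d_meas[OF ij(1)]
      by (intro integral_distr[OF measurable_component_singleton[OF ij(1)], symmetric]
          borel_measurable_times)
    also have "distr (PiM I M) (M i) (\<lambda>x. x i) = M i"
      by (rule PiM_component[OF ij(1)])
    also have "(\<integral>a. d i a * d i a \<partial>M i) = (\<integral>a. (1 - 2 * p i) * indicator (S i) a + p i * p i \<partial>M i)"
      by (intro Bochner_Integration.integral_cong) (auto simp: d_def indicator_def algebra_simps)
    also have "\<dots> = (1 - 2 * p i) * p i + p i * p i"
      using S[OF ij(1)] int_ind[OF ij(1)] by (subst Bochner_Integration.integral_add) (auto simp: p_def M.prob_space)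
    also have "\<dots> = p i - p i * p i" by (simp add: algebra_simps)
    finally show ?thesis using True p[OF ij(1)] by simp
  next
    case False
    have "P.expectation (\<lambda>x. d i (x i) * d j (x j)) =
      P.expectation (\<lambda>x. \<Prod>l\<in>I. (if l = i then d i (x l) else if l = j then d j (x l) else 1))"
    proof (intro Bochner_Integration.integral_cong refl)
      fix x
      show "d i (x i) * d j (x j) = (\<Prod>l\<in>I. (if l = i then d i (x l) else if l = j then d j (x l) else 1))"
        using I ij False by (simp add: prod.remove[OF I ij(1)] prod.remove[of "I - {i}" j])
    qed
    also have "\<dots> = (\<Prod>l\<in>I. \<integral>a. (if l = i then d i a else if l = j then d j a else 1) \<partial>M l)"
    proof (rule product_integral_prod[OF I])
      fix l assume l: "l \<in> I"
      show "integrable (M l) (\<lambda>a. if l = i then d i a else if l = j then d j a else 1)"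
        using d_int l by (cases "l = i"; cases "l = j") auto
    qed
    also have "\<dots> = 0"
      using I ij d_mean[OF ij(1)] by (intro prod_zero bexI[of _ i]) auto
    finally show ?thesis using False by simp
  qed
  have int: "integrable (PiM I M) (\<lambda>x. d i (x i) * d j (x j))" if "i \<in> I" "j \<in> I" for i j
    using that d1 by (intro P.integrable_const_bound[where B = 1])
      (auto simp: abs_mult intro!: mult_le_one)
  have "P.expectation (\<lambda>x. (\<Sum>i\<in>I. d i (x i))\<^sup>2) = P.expectation (\<lambda>x. \<Sum>i\<in>I. \<Sum>j\<in>I. d i (x i) * d j (x j))"
    by (simp add: power2_eq_square sum_product)
  also have "\<dots> = (\<Sum>i\<in>I. \<Sum>j\<in>I. P.expectation (\<lambda>x. d i (x i) * d j (x j)))"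
    using int by (simp add: Bochner_Integration.integral_sum Bochner_Integration.integrable_sum)
  also have "\<dots> \<le> (\<Sum>i\<in>I. \<Sum>j\<in>I. if i = j then p i else 0)"
    by (intro sum_mono cross)
  also have "\<dots> = (\<Sum>i\<in>I. p i)" using I by simp
  finally show ?thesis by (simp add: d_def p_def)
qed

section \<open>The over-sampled spectrum\<close>

definition spectrum :: "nat \<Rightarrow> nat \<Rightarrow> (nat \<Rightarrow> complex) \<Rightarrow> nat \<Rightarrow> complex" where
  "spectrum q N y m = (\<Sum>j=1..N. oversampled_dft q N m j * y j)"

lemma sqrt_periodogram: "sqrt (periodogram q N y m) = cmod (spectrum q N y m)"
  by (simp add: periodogram_def spectrum_def)

lemma sum_by_residue_class:
  fixes f :: "nat \<Rightarrow> 'a::comm_monoid_add"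
  shows "(\<Sum>m=1..N * L. f m) = (\<Sum>l<L. \<Sum>k<N. f (k * L + l + 1))"
proof -
  have "(\<Sum>m=1..N * L. f m) = (\<Sum>m<N * L. f (m + 1))"
    by (rule sum.reindex_bij_witness[of _ Suc "\<lambda>m. m - 1"]) auto
  also have "\<dots> = (\<Sum>k<N. \<Sum>m = k * L..<k * L + L. f (m + 1))"
    by (rule sum.nat_group[symmetric])
  also have "\<dots> = (\<Sum>k<N. \<Sum>l<L. f (k * L + l + 1))"
  proof (rule sum.cong[OF refl])
    fix k
    show "(\<Sum>m = k * L..<k * L + L. f (m + 1)) = (\<Sum>l<L. f (k * L + l + 1))"
      by (rule sum.reindex_bij_witness[of _ "\<lambda>l. k * L + l" "\<lambda>m. m - k * L"]) auto
  qed
  finally show ?thesis by (subst sum.swap)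
qed

text \<open>
  Two frequencies of one class differ by a multiple of \<open>1 / N\<close>; their common offset \<open>l / (N L)\<close> cancels and
  what remains is a sum over powers of an \<open>N\<close>-th root of unity.
\<close>

lemma oversampled_dft_orthonormal:
  assumes L: "0 < L" and k: "k < N" "k' < N"
  shows "(\<Sum>j=1..N. oversampled_dft (N * L) N (k * L + l + 1) j *
      cnj (oversampled_dft (N * L) N (k' * L + l + 1) j)) = of_bool (k = k')"
proof -
  have N: "0 < N" using k by simp
  define w where "w = exp (of_real (2 * pi * (real k - real k') / real N) * \<i>)"
  have entry: "oversampled_dft (N * L) N (k * L + l + 1) (Suc j) *
      cnj (oversampled_dft (N * L) N (k' * L + l + 1) (Suc j)) = of_real (1 / real N) * w ^ j" for j
  proof -
    have "2 * of_real pi * \<i> * (of_nat (k * L + l + 1) - 1) * (of_nat (Suc j) - 1) / of_nat (N * L) -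
        2 * of_real pi * \<i> * (of_nat (k' * L + l + 1) - 1) * (of_nat (Suc j) - 1) / of_nat (N * L) =
        of_nat j * (of_real (2 * pi * (real k - real k') / real N) * \<i>)"
      using L N by (simp add: field_simps)
    then show ?thesis
      unfolding oversampled_dft_def w_def exp_of_nat_mult[symmetric]
      by (simp add: exp_cnj mult_ac flip: exp_add of_real_mult)
  qed
  have "(\<Sum>j=1..N. oversampled_dft (N * L) N (k * L + l + 1) j *
      cnj (oversampled_dft (N * L) N (k' * L + l + 1) j)) = (\<Sum>j<N. of_real (1 / real N) * w ^ j)"
    unfolding entry[symmetric] by (rule sum.reindex_bij_witness[of _ Suc "\<lambda>m. m - 1"]) auto
  also have "\<dots> = of_real (1 / real N) * (\<Sum>j<N. w ^ j)" by (simp add: sum_distrib_left)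
  also have "\<dots> = of_bool (k = k')"
  proof (cases "k = k'")
    case True
    then show ?thesis using N by (simp add: w_def)
  next
    case False
    have "w ^ N = 1"
    proof -
      have "w ^ N = exp (of_real (2 * of_int (int k - int k') * pi) * \<i>)"
      proof -
        have "real N * (2 * pi * (real k - real k') / real N) = 2 * of_int (int k - int k') * pi"
          using N by simp
        moreover have "of_nat N * (of_real x * \<i>) = of_real (real N * x) * \<i>" for x
          by simp
        ultimately have "of_nat N * (of_real (2 * pi * (real k - real k') / real N) * \<i>) =
            of_real (2 * of_int (int k - int k') * pi) * \<i>"
          by (simp only:)
        then show ?thesis unfolding w_def exp_of_nat_mult[symmetric] by simp
      qed
      moreover have "exp (of_real (2 * of_int (int k - int k') * pi) * \<i>) = 1"
        unfolding exp_eq_1 by (intro conjI exI[of _ "int k - int k'"]) simp_all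
      ultimately show ?thesis by simp
    qed
    moreover have "w \<noteq> 1"
    proof
      assume "w = 1"
      then obtain n :: int where "2 * pi * (real k - real k') / real N = of_int (2 * n) * pi"
        by (auto simp: w_def exp_eq_1)
      then have "(2 * pi) * (real k - real k') = (2 * pi) * (of_int n * real N)"
        using N by (simp add: field_simps)
      then have "real k - real k' = of_int n * real N"
        by (subst (asm) mult_cancel_left) simp
      then have "real_of_int (int k - int k') = real_of_int (n * int N)"
        by simp
      then have eq: "int k - int k' = n * int N" by (simp only: of_int_eq_iff)
      have "\<bar>int k - int k'\<bar> < int N" using k by linarith
      then have "\<bar>n\<bar> * int N < 1 * int N" using eq by (simp add: abs_mult)
      then have "n = 0" using N by simp
      then show False using eq False by simp
    qed
    ultimately show ?thesis using False by (simp add: geometric_sum)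
  qed
  finally show ?thesis .
qed

lemma law_spectrum_residue_class:
  assumes "0 < L"
  shows "distr (noise N) (\<Pi>\<^sub>M k\<in>{..<N}. borel) (\<lambda>z. \<lambda>k\<in>{..<N}. spectrum (N * L) N z (k * L + l + 1)) =
    (\<Pi>\<^sub>M k\<in>{..<N}. std_complex_normal)"
  unfolding spectrum_def using assms
  by (intro law_orthonormal_noise oversampled_dft_orthonormal) auto

lemma spectrum_measurable [measurable]: "(\<lambda>z. spectrum q N z m) \<in> borel_measurable (\<Pi>\<^sub>M t\<in>{1..N}. borel)"
  unfolding spectrum_def by measurable

lemma spectrum_measurable_noise [measurable]: "(\<lambda>z. spectrum q N z m) \<in> borel_measurable (noise N)"
  using spectrum_measurable by measurable

lemma null_class_count_tail:
  assumes L: "0 < L" and lam: "0 \<le> lam" and t: "0 \<le> t"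
  shows "measure (noise N) {z \<in> space (noise N).
      u \<le> (\<Sum>k<N. of_bool (t \<le> cmod (spectrum (N * L) N z (k * L + l + 1))))}
    \<le> exp ((exp lam - 1) * (real N * exp (- t\<^sup>2)) - lam * u)"
proof -
  interpret S: prob_space std_complex_normal by (rule prob_space_std_complex_normal)
  interpret P: product_prob_space "\<lambda>_::nat. std_complex_normal" "{..<N}" by unfold_locales
  let ?V = "\<lambda>z. \<lambda>k\<in>{..<N}. spectrum (N * L) N z (k * L + l + 1)"
  let ?B = "\<Pi>\<^sub>M k\<in>{..<N}. (borel :: complex measure)"
  let ?A = "{z. t \<le> cmod z}"
  have V: "?V \<in> noise N \<rightarrow>\<^sub>M ?B" by (intro measurable_restrict) measurable
  have sets: "sets (\<Pi>\<^sub>M k\<in>{..<N}. std_complex_normal) = sets ?B" by (intro sets_PiM_cong) auto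
  have space: "space (\<Pi>\<^sub>M k\<in>{..<N}. std_complex_normal) = space ?B" by (simp add: space_PiM)
  let ?E = "{x \<in> space ?B. u \<le> (\<Sum>k<N. indicator ?A (x k))}"
  have E: "?E \<in> sets ?B" by measurable
  have count: "(\<Sum>k<N. of_bool (t \<le> cmod (spectrum (N * L) N z (k * L + l + 1)))) =
      (\<Sum>k<N. indicator ?A (?V z k) :: real)" for z
    by (intro sum.cong) (auto simp: indicator_def)
  have "measure (noise N) {z \<in> space (noise N).
      u \<le> (\<Sum>k<N. of_bool (t \<le> cmod (spectrum (N * L) N z (k * L + l + 1))))} =
      measure (noise N) (?V -` ?E \<inter> space (noise N))"
    unfolding count using measurable_space[OF V]
    by (intro arg_cong[where f = "measure _"]) (auto simp del: restrict_apply)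
  also have "\<dots> = measure (distr (noise N) ?B ?V) ?E"
    by (rule measure_distr[OF V E, symmetric])
  also have "\<dots> = measure (\<Pi>\<^sub>M k\<in>{..<N}. std_complex_normal)
      {x \<in> space (\<Pi>\<^sub>M k\<in>{..<N}. std_complex_normal). u \<le> (\<Sum>k<N. indicator ?A (x k))}"
    by (simp only: law_spectrum_residue_class[OF L] space)
  also have "\<dots> \<le> exp ((exp lam - 1) * (\<Sum>k<N. measure std_complex_normal ?A) - lam * u)"
    using lam by (intro P.count_upper_tail[where S = "\<lambda>_. ?A"]) auto
  also have "measure std_complex_normal ?A = exp (- t\<^sup>2)"
    using gauss_tail_0[OF t] by simp
  finally show ?thesis by simp
qed

lemma class_count_variance_le:
  fixes \<mu> :: "nat \<Rightarrow> complex"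
  assumes L: "0 < L"
  shows "(\<integral>z. (\<Sum>k<N. of_bool (t \<le> cmod (\<mu> k + spectrum (N * L) N z (k * L + l + 1))) - gauss_tail (\<mu> k) t)\<^sup>2 \<partial>noise N)
     \<le> (\<Sum>k<N. gauss_tail (\<mu> k) t)"
proof -
  interpret S: prob_space std_complex_normal by (rule prob_space_std_complex_normal)
  interpret P: product_prob_space "\<lambda>_::nat. std_complex_normal" "{..<N}" by unfold_locales
  let ?V = "\<lambda>z. \<lambda>k\<in>{..<N}. spectrum (N * L) N z (k * L + l + 1)"
  let ?B = "\<Pi>\<^sub>M k\<in>{..<N}. (borel :: complex measure)"
  let ?A = "\<lambda>k. {z. t \<le> cmod (\<mu> k + z)}"
  have V: "?V \<in> noise N \<rightarrow>\<^sub>M ?B" by (intro measurable_restrict) measurable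
  have "(\<integral>z. (\<Sum>k<N. of_bool (t \<le> cmod (\<mu> k + spectrum (N * L) N z (k * L + l + 1))) - gauss_tail (\<mu> k) t)\<^sup>2 \<partial>noise N) =
     (\<integral>z. (\<Sum>k<N. indicator (?A k) (?V z k) - gauss_tail (\<mu> k) t)\<^sup>2 \<partial>noise N)"
    by (intro Bochner_Integration.integral_cong) (auto simp: indicator_def intro!: arg_cong[where f = "\<lambda>x. x\<^sup>2"] sum.cong)
  also have "\<dots> = (\<integral>x. (\<Sum>k<N. indicator (?A k) (x k) - gauss_tail (\<mu> k) t)\<^sup>2 \<partial>distr (noise N) ?B ?V)"
    by (rule integral_distr[OF V, symmetric]) measurable
  also have "\<dots> \<le> (\<Sum>k<N. gauss_tail (\<mu> k) t)"
    unfolding law_spectrum_residue_class[OF L] by (rule P.count_variance_le[where S = ?A]) auto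
  finally show ?thesis .
qed

text \<open>
  Chebyshev's inequality for the total count. The classes may depend on each other arbitrarily: by
  Cauchy--Schwarz the variance of their sum is at most \<open>L\<close> times the sum of their variances.
\<close>

lemma count_lower_tail:
  fixes \<mu> :: "nat \<Rightarrow> complex"
  assumes L: "0 < L" and w: "w < (\<Sum>m=1..N * L. gauss_tail (\<mu> m) t)"
  shows "measure (noise N) {z \<in> space (noise N).
       (\<Sum>m=1..N * L. of_bool (t \<le> cmod (\<mu> m + spectrum (N * L) N z m))) \<le> w}
    \<le> real L * (\<Sum>m=1..N * L. gauss_tail (\<mu> m) t) / ((\<Sum>m=1..N * L. gauss_tail (\<mu> m) t) - w)\<^sup>2"
proof -
  interpret prob_space "noise N" by (rule prob_space_noise)
  define P where "P m = gauss_tail (\<mu> m) t" for m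
  define E where "E = (\<Sum>m=1..N * L. P m)"
  define d :: "(nat \<Rightarrow> complex) \<Rightarrow> nat \<Rightarrow> real"
    where "d z m = of_bool (t \<le> cmod (\<mu> m + spectrum (N * L) N z m)) - P m" for z m
  have [measurable]: "(\<lambda>z. d z m) \<in> borel_measurable (noise N)" for m
    unfolding d_def by measurable
  have P01: "0 \<le> P m" "P m \<le> 1" for m
    using prob_space.prob_le_1[OF prob_space_std_complex_normal] by (auto simp: P_def)
  have d1: "\<bar>d z m\<bar> \<le> 1" for z m using P01[of m] by (auto simp: d_def)
  define D where "D l z = (\<Sum>k<N. d z (k * L + l + 1))" for l z
  have [measurable]: "D l \<in> borel_measurable (noise N)" for l unfolding D_def[abs_def] by measurable
  have D_bound: "\<bar>D l z\<bar> \<le> real N" for l z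
  proof -
    have "\<bar>D l z\<bar> \<le> (\<Sum>k<N. \<bar>d z (k * L + l + 1)\<bar>)" unfolding D_def by (rule sum_abs)
    also have "\<dots> \<le> (\<Sum>k<N. 1)" by (intro sum_mono d1)
    finally show ?thesis by simp
  qed
  have int: "integrable (noise N) (\<lambda>z. (D l z)\<^sup>2)" for l
  proof (rule integrable_const_bound[where B = "(real N)\<^sup>2"])
    show "AE z in noise N. norm ((D l z)\<^sup>2) \<le> (real N)\<^sup>2"
      using D_bound[of l] by (auto simp: abs_le_square_iff[symmetric])
  qed measurable
  have var: "expectation (\<lambda>z. (D l z)\<^sup>2) \<le> (\<Sum>k<N. P (k * L + l + 1))" for l
    unfolding D_def d_def P_def by (rule class_count_variance_le[OF L])
  have tot: "(\<Sum>m=1..N * L. d z m) = (\<Sum>l<L. D l z)" for z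
    unfolding D_def by (rule sum_by_residue_class)
  have cs: "(\<Sum>l<L. D l z)\<^sup>2 \<le> real L * (\<Sum>l<L. (D l z)\<^sup>2)" for z
    using sum_squared_le_sum_of_squares[of "\<lambda>l. D l z" "{..<L}"] by (simp add: mult.commute)
  have int2: "integrable (noise N) (\<lambda>z. real L * (\<Sum>l<L. (D l z)\<^sup>2))"
    using int by (intro integrable_mult_right Bochner_Integration.integrable_sum)
  have a: "0 < (E - w)\<^sup>2" using w by (simp add: E_def P_def)
  have "measure (noise N) {z \<in> space (noise N).
       (\<Sum>m=1..N * L. of_bool (t \<le> cmod (\<mu> m + spectrum (N * L) N z m))) \<le> w} \<le>
     measure (noise N) {z \<in> space (noise N). (E - w)\<^sup>2 \<le> real L * (\<Sum>l<L. (D l z)\<^sup>2)}"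
  proof (intro finite_measure_mono subsetI CollectI conjI)
    fix z assume z: "z \<in> {z \<in> space (noise N).
       (\<Sum>m=1..N * L. of_bool (t \<le> cmod (\<mu> m + spectrum (N * L) N z m))) \<le> w}"
    then show "z \<in> space (noise N)" by simp
    have "(\<Sum>m=1..N * L. d z m) \<le> w - E"
      using z by (simp add: d_def E_def sum_subtractf)
    then have "(E - w)\<^sup>2 \<le> (\<Sum>m=1..N * L. d z m)\<^sup>2"
      using w unfolding E_def[symmetric] P_def[symmetric] by (intro abs_le_square_iff[THEN iffD1]) simp
    then show "(E - w)\<^sup>2 \<le> real L * (\<Sum>l<L. (D l z)\<^sup>2)" using cs[of z] unfolding tot by linarith
  qed measurable
  also have "\<dots> \<le> expectation (\<lambda>z. real L * (\<Sum>l<L. (D l z)\<^sup>2)) / (E - w)\<^sup>2"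
    by (rule integral_Markov_inequality_measure[OF int2, of "{}"]) (use a in \<open>auto intro!: mult_nonneg_nonneg sum_nonneg\<close>)
  also have "expectation (\<lambda>z. real L * (\<Sum>l<L. (D l z)\<^sup>2)) = real L * (\<Sum>l<L. expectation (\<lambda>z. (D l z)\<^sup>2))"
    using int by (simp add: Bochner_Integration.integral_sum)
  also have "\<dots> / (E - w)\<^sup>2 \<le> real L * (\<Sum>l<L. \<Sum>k<N. P (k * L + l + 1)) / (E - w)\<^sup>2"
    using var a by (intro divide_right_mono mult_left_mono sum_mono) auto
  also have "(\<Sum>l<L. \<Sum>k<N. P (k * L + l + 1)) = E"
    unfolding E_def by (rule sum_by_residue_class[symmetric])
  finally show ?thesis by (simp add: E_def P_def)
qed

section \<open>Class counts and the higher criticism statistic\<close>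

abbreviation oversampling :: "nat \<Rightarrow> nat" where
  "oversampling N \<equiv> nat \<lfloor>ln (real N) + 1\<rfloor>"

definition class_count :: "nat \<Rightarrow> nat \<Rightarrow> (nat \<Rightarrow> complex) \<Rightarrow> nat \<Rightarrow> real \<Rightarrow> real" where
  "class_count L N y l t = (\<Sum>k<N. of_bool (t \<le> cmod (spectrum (N * L) N y (k * L + l + 1))))"

lemma HC_eq_class_counts:
  "HC (N * L) N y t =
    (\<Sum>l<L. class_count L N y l t - real N * Psi_bar t) / sqrt (real (N * L) * Psi_bar t * (1 - Psi_bar t))"
  unfolding HC_def sqrt_periodogram sum_by_residue_class class_count_def
  by (simp add: sum_subtractf mult_ac)

lemma Psi_bar_range:
  assumes N: "9 \<le> N" and t: "t \<in> {1..sqrt (ln (real N / 3))}"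
  shows "3 \<le> real N * Psi_bar t" "Psi_bar t \<le> 1 / 2" "0 < Psi_bar t"
proof -
  have "t\<^sup>2 \<le> ln (real N / 3)"
    using t N by (intro sqrt_ge_absD) auto
  then have "exp (t\<^sup>2) \<le> real N / 3"
    using N by (simp add: ln_ge_iff)
  then show "3 \<le> real N * Psi_bar t"
    by (simp add: Psi_bar_def exp_minus field_simps)
  have "1 \<le> t\<^sup>2" using t by simp
  then have "2 \<le> exp (t\<^sup>2)" using exp_ge_add_one_self[of "t\<^sup>2"] by linarith
  then show "Psi_bar t \<le> 1 / 2" by (simp add: Psi_bar_def exp_minus field_simps)
qed (simp add: Psi_bar_def)

lemma HC_variance_ge:
  assumes N: "9 \<le> N" and L: "0 < L" and t: "t \<in> {1..sqrt (ln (real N / 3))}"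
  shows "1 \<le> sqrt (real (N * L) * Psi_bar t * (1 - Psi_bar t))"
proof -
  note P = Psi_bar_range[OF N t]
  have "1 * (3 * (1 / 2)) \<le> real L * ((real N * Psi_bar t) * (1 - Psi_bar t))"
    using P L by (intro mult_mono mult_nonneg_nonneg) auto
  also have "\<dots> = real (N * L) * Psi_bar t * (1 - Psi_bar t)" by simp
  finally show ?thesis by simp
qed

text \<open>
  Some class has at least the average share of the excess. Rounding \<open>N * Psi_bar t\<close> up to the integer \<open>i\<close>
  replaces \<open>t\<close> by one of finitely many levels at the expense of 1 in the centring: the level decreases,
  so the count can only grow.
\<close>

lemma HC_large_imp_class_count_large:
  assumes N: "9 \<le> N" and L: "0 < L" and t: "t \<in> {1..sqrt (ln (real N / 3))}"
    and w: "0 \<le> w" "w < HC (N * L) N y t"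
  shows "\<exists>l<L. \<exists>i\<in>{3..N}.
    real i - 1 + w * sqrt (real i / (3 * real L)) \<le> class_count L N y l (sqrt (ln (real N / real i)))"
proof -
  note P = Psi_bar_range[OF N t]
  define \<psi> where "\<psi> = Psi_bar t"
  define D where "D = sqrt (real (N * L) * \<psi> * (1 - \<psi>))"
  have D1: "1 \<le> D" unfolding D_def \<psi>_def by (rule HC_variance_ge[OF N L t])
  have "w * D < (\<Sum>l<L. class_count L N y l t - real N * \<psi>)"
    using w(2) D1 unfolding HC_eq_class_counts \<psi>_def[symmetric] D_def[symmetric]
    by (simp add: field_simps)
  also have "w * D = (\<Sum>l<L. w * D / real L)" using L by simp
  finally obtain l where l: "l < L" "w * D / real L < class_count L N y l t - real N * \<psi>"
    using sum_mono[of "{..<L}" "\<lambda>l. class_count L N y l t - real N * \<psi>" "\<lambda>_. w * D / real L"]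
    by (meson lessThan_iff not_le)
  define i where "i = nat \<lceil>real N * \<psi>\<rceil>"
  have i: "real N * \<psi> \<le> real i" "real i - 1 < real N * \<psi>"
    using P unfolding i_def \<psi>_def by linarith+
  have i3: "3 \<le> i" using i(1) P(1) unfolding \<psi>_def by linarith
  have "real N * \<psi> \<le> real N * 1" using P unfolding \<psi>_def by (intro mult_left_mono) auto
  then have iN: "i \<le> N" using i(2) by linarith
  have "sqrt (ln (real N / real i)) \<le> t"
  proof (rule real_le_lsqrt)
    show "0 \<le> t" using t by simp
    have "real N * exp (- t\<^sup>2) \<le> real i" using i(1) by (simp add: \<psi>_def Psi_bar_def)
    then have "real N / real i \<le> exp (t\<^sup>2)" using i3 by (simp add: field_simps exp_minus)
    then show "ln (real N / real i) \<le> t\<^sup>2"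
      using N i3 ln_le_cancel_iff[of "real N / real i" "exp (t\<^sup>2)"] by simp
  qed
  then have mono: "class_count L N y l t \<le> class_count L N y l (sqrt (ln (real N / real i)))"
    unfolding class_count_def by (intro sum_mono) auto
  have "sqrt (real i / (3 * real L)) \<le> D / real L"
  proof (rule real_le_lsqrt)
    have "real i / 3 = (2 / 3 * real i) * (1 / 2)" by simp
    also have "\<dots> \<le> (real N * \<psi>) * (1 - \<psi>)"
    proof (rule mult_mono)
      show "2 / 3 * real i \<le> real N * \<psi>" using i(2) i3 by linarith
      show "1 / 2 \<le> 1 - \<psi>" "0 \<le> real N * \<psi>" using P unfolding \<psi>_def by linarith+
    qed simp
    finally have "real i / 3 / real L \<le> (real N * \<psi>) * (1 - \<psi>) / real L"
      using L by (intro divide_right_mono) auto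
    also have "\<dots> = (D / real L)\<^sup>2"
    proof -
      have "0 \<le> real (N * L) * \<psi> * (1 - \<psi>)" using P by (auto simp: \<psi>_def)
      then have "D\<^sup>2 = real (N * L) * \<psi> * (1 - \<psi>)" by (simp add: D_def)
      then show ?thesis using L by (simp add: power_divide power2_eq_square)
    qed
    finally show "real i / (3 * real L) \<le> (D / real L)\<^sup>2" by simp
  qed (use D1 in auto)
  then have "w * sqrt (real i / (3 * real L)) \<le> w * D / real L"
    using w(1) by (metis mult_left_mono times_divide_eq_right)
  then have "real i - 1 + w * sqrt (real i / (3 * real L)) \<le> class_count L N y l (sqrt (ln (real N / real i)))"
    using l(2) mono i(2) by linarith
  then show ?thesis using l(1) i3 iN by (intro exI[of _ l] conjI bexI[of _ i]) auto
qed

section \<open>From observations to noise\<close>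

lemma class_count_measurable [measurable]:
  "(\<lambda>y. class_count L N y l t) \<in> borel_measurable (\<Pi>\<^sub>M t\<in>{1..N}. borel)"
  unfolding class_count_def by measurable

lemma obs_map_measurable [measurable]:
  "(\<lambda>z. \<lambda>j\<in>{1..N}. m j + z j) \<in> noise N \<rightarrow>\<^sub>M (\<Pi>\<^sub>M j\<in>{1..N}. (borel :: complex measure))"
proof (rule measurable_restrict)
  fix j assume "j \<in> {1..N}"
  then have [measurable]: "(\<lambda>z. z j) \<in> borel_measurable (noise N)"
    by (subst measurable_cong_sets[OF sets_noise refl]) (rule measurable_component_singleton)
  show "(\<lambda>z. m j + z j) \<in> borel_measurable (noise N)" by measurable
qed

lemma spectrum_shift:
  "spectrum q N (\<lambda>j\<in>{1..N}. m j + z j) k = spectrum q N m k + spectrum q N z k"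
  unfolding spectrum_def by (simp add: algebra_simps sum.distrib)

text \<open>
  Acceptance and rejection involve a supremum over uncountably many thresholds. To avoid the question whether
  such a \<open>P\<close> is measurable, a measurable \<open>Q\<close> takes its place before the law is pulled back to the noise.
\<close>

lemma prob_obs_law_le:
  assumes PQ: "\<And>y. P y \<Longrightarrow> Q y" and Q [measurable]: "Measurable.pred (\<Pi>\<^sub>M j\<in>{1..N}. borel) Q"
  shows "\<P>(y in obs_law p N \<beta>. P y) \<le>
    \<P>(z in noise N. Q (\<lambda>j\<in>{1..N}. (\<Sum>k=1..p. design p j k * \<beta> k) + z j))"
proof -
  interpret prob_space "noise N" by (rule prob_space_noise)
  interpret O: prob_space "obs_law p N \<beta>"
    unfolding obs_law_def by (rule prob_space_distr) measurable
  have space: "space (obs_law p N \<beta>) = space (\<Pi>\<^sub>M j\<in>{1..N}. (borel :: complex measure))"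
    by (simp add: obs_law_def)
  have QS: "{y \<in> space (\<Pi>\<^sub>M j\<in>{1..N}. (borel :: complex measure)). Q y} \<in> sets (\<Pi>\<^sub>M j\<in>{1..N}. borel)"
    by measurable
  have "\<P>(y in obs_law p N \<beta>. P y) \<le> \<P>(y in obs_law p N \<beta>. Q y)"
    using QS PQ by (intro O.finite_measure_mono) (auto simp: obs_law_def)
  also have "\<dots> = \<P>(z in noise N. Q (\<lambda>j\<in>{1..N}. (\<Sum>k=1..p. design p j k * \<beta> k) + z j))"
    unfolding space using QS measurable_space[OF obs_map_measurable]
    by (simp add: obs_law_def measure_distr)
       (auto intro!: arg_cong[where f = "measure _"] simp del: restrict_apply)
  finally show ?thesis .
qed

section \<open>False rejection\<close>

text \<open>
  The union bound runs over \<open>L\<close> classes and fewer than \<open>N\<close> levels. Every term gets the same estimate since, at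
  the level of expected class count \<open>i\<close>, the Chernoff exponent is taken to be \<open>1 / sqrt i\<close>, the inverse of
  the standard deviation.
\<close>

lemma null_rejection_le:
  assumes N: "9 \<le> N"
  defines "L \<equiv> oversampling N"
  shows "\<P>(y in obs_law p N (\<lambda>_. 0). ophc_rejects N y) \<le>
    real L * real N * exp (2 - (ln (real N))\<^sup>2 / sqrt (3 * real L))"
proof -
  interpret prob_space "noise N" by (rule prob_space_noise)
  define w where "w = (ln (real N))\<^sup>2"
  have lnN: "0 < ln (real N)" using N by simp
  then have L: "0 < L" unfolding L_def by linarith
  define thr where "thr i = real i - 1 + w * sqrt (real i / (3 * real L))" for i :: nat
  define tt where "tt i = sqrt (ln (real N / real i))" for i :: nat
  let ?Q = "\<lambda>y. \<exists>l<L. \<exists>i\<in>{3..N}. thr i \<le> class_count L N y l (tt i)"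
  have "\<P>(y in obs_law p N (\<lambda>_. 0). ophc_rejects N y) \<le>
    \<P>(z in noise N. ?Q (\<lambda>j\<in>{1..N}. (\<Sum>k=1..p. design p j k * 0) + z j))"
  proof (rule prob_obs_law_le)
    fix y assume "ophc_rejects N y"
    then have "w < (SUP t\<in>{1..sqrt (ln (real N / 3))}. HC (N * L) N y t)"
      unfolding ophc_rejects_def HC_star_def w_def L_def .
    moreover have "1 \<le> sqrt (ln (real N / 3))"
    proof -
      have "exp 1 \<le> real N / 3" using N exp_le by linarith
      then have "1 \<le> ln (real N / 3)" using N by (simp add: ln_ge_iff)
      then show ?thesis by simp
    qed
    ultimately obtain t where "t \<in> {1..sqrt (ln (real N / 3))}" "w < HC (N * L) N y t"
      by (elim less_cSupE) auto
    then show "?Q y"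
      unfolding thr_def tt_def by (intro HC_large_imp_class_count_large N L) (auto simp: w_def)
  qed measurable
  also have "\<dots> = measure (noise N) (\<Union>(l, i)\<in>{..<L} \<times> {3..N}.
      {z \<in> space (noise N). thr i \<le> class_count L N z l (tt i)})"
  proof (intro arg_cong[where f = "measure _"])
    have "class_count L N (\<lambda>j\<in>{1..N}. (\<Sum>k=1..p. design p j k * 0) + z j) l t = class_count L N z l t" for z l t
      unfolding class_count_def spectrum_shift by (simp add: spectrum_def)
    then show "{z \<in> space (noise N). ?Q (\<lambda>j\<in>{1..N}. (\<Sum>k=1..p. design p j k * 0) + z j)} =
      (\<Union>(l, i)\<in>{..<L} \<times> {3..N}. {z \<in> space (noise N). thr i \<le> class_count L N z l (tt i)})"
      by (simp only:) auto
  qed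
  also have "\<dots> \<le> (\<Sum>(l, i)\<in>{..<L} \<times> {3..N}.
      measure (noise N) {z \<in> space (noise N). thr i \<le> class_count L N z l (tt i)})"
    unfolding case_prod_beta
  proof (rule finite_measure_subadditive_finite)
    have [measurable]: "(\<lambda>z. class_count L N z l t) \<in> borel_measurable (noise N)" for l t
      unfolding class_count_def by measurable
    show "(\<lambda>x. {z \<in> space (noise N). thr (snd x) \<le> class_count L N z (fst x) (tt (snd x))}) `
        ({..<L} \<times> {3..N}) \<subseteq> events"
      by (intro image_subsetI) measurable
  qed simp
  also have "\<dots> \<le> (\<Sum>(l, i)\<in>{..<L} \<times> {3..N}. exp (2 - w / sqrt (3 * real L)))"
    unfolding case_prod_beta
  proof (intro sum_mono)
    fix x assume x: "x \<in> {..<L} \<times> {3..N}"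
    define i where "i = snd x"
    have i: "3 \<le> i" "i \<le> N" using x by (auto simp: i_def)
    \<comment> \<open>Then \<open>(exp lam - 1) i \<le> sqrt i + 1\<close> and \<open>lam (i - 1) \<ge> sqrt i - 1\<close>, which gives the constant 2.\<close>
    define lam where "lam = 1 / sqrt (real i)"
    have lam: "0 < lam" "lam \<le> 1" "lam * sqrt (real i) = 1" "lam\<^sup>2 * real i = 1"
      using i by (auto simp: lam_def power_divide)
    have lam_i: "lam * real i = sqrt (real i)" using i by (simp add: lam_def real_div_sqrt)
    have nn: "0 \<le> ln (real N / real i)" using i by simp
    have Ni: "real N * exp (- (tt i)\<^sup>2) = real i"
      using i nn by (simp add: tt_def exp_minus field_simps)
    have "measure (noise N) {z \<in> space (noise N). thr i \<le> class_count L N z (fst x) (tt i)} \<le>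
      exp ((exp lam - 1) * (real N * exp (- (tt i)\<^sup>2)) - lam * thr i)"
      unfolding class_count_def using lam nn by (intro null_class_count_tail L) (auto simp: tt_def)
    also have "\<dots> \<le> exp (2 - w / sqrt (3 * real L))"
    proof -
      have "(exp lam - 1) * real i \<le> (lam + lam\<^sup>2) * real i"
        using exp_bound[of lam] lam by (intro mult_right_mono) auto
      also have "\<dots> = sqrt (real i) + 1" using lam lam_i by (simp add: algebra_simps)
      finally have 1: "(exp lam - 1) * real i \<le> sqrt (real i) + 1" .
      have "lam * sqrt (real i / (3 * real L)) = 1 / sqrt (3 * real L)"
        using lam(3) by (simp add: real_sqrt_divide real_sqrt_mult)
      then have "lam * thr i = sqrt (real i) - lam + w / sqrt (3 * real L)"
        using lam_i mult.left_commute[of lam w "sqrt (real i / (3 * real L))"]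
        unfolding thr_def by (simp add: distrib_left right_diff_distrib del: real_sqrt_divide)
      then show ?thesis using 1 lam(2) unfolding Ni by simp
    qed
    finally show "measure (noise N) {z \<in> space (noise N). thr (snd x) \<le> class_count L N z (fst x) (tt (snd x))} \<le>
      exp (2 - w / sqrt (3 * real L))" by (simp add: i_def)
  qed
  also have "\<dots> = real L * real (N - 2) * exp (2 - w / sqrt (3 * real L))"
    by (simp add: case_prod_beta)
  also have "\<dots> \<le> real L * real N * exp (2 - w / sqrt (3 * real L))"
    by (intro mult_right_mono mult_left_mono) auto
  finally show ?thesis by (simp add: w_def)
qed

section \<open>False acceptance\<close>

text \<open>
  Let \<open>Q = q Psi_bar t\<close> and let \<open>A\<close> be the expected excess over \<open>Q\<close>. Acceptance forces the count to stay below
  \<open>Q + A / 2\<close>, that is, \<open>A / 2\<close> below its mean \<open>Q + A\<close>, and its variance is at most \<open>L (Q + A)\<close>. Both \<open>Q / A\<^sup>2\<close> and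
  \<open>1 / A\<close> are small by the assumption on the excess.
\<close>

lemma alternative_acceptance_le:
  assumes N: "9 \<le> N" and t: "t \<in> {1..sqrt (ln (real N / 3))}"
  defines "L \<equiv> oversampling N"
  assumes excess: "2 * (ln (real N))\<^sup>2 * sqrt (real (N * L) * Psi_bar t) \<le>
     (\<Sum>m=1..N * L. gauss_tail (spectrum (N * L) N (\<lambda>j. \<Sum>k=1..p. design p j k * \<beta> k) m) t - Psi_bar t)"
  shows "\<P>(y in obs_law p N \<beta>. \<not> ophc_rejects N y) \<le> 5 * real L / (ln (real N))\<^sup>2"
proof -
  note P = Psi_bar_range[OF N t]
  define w where "w = (ln (real N))\<^sup>2"
  have "1 \<le> ln (real N)" using N exp_le by (subst ln_ge_iff) auto
  then have w1: "1 \<le> w" and L: "0 < L" unfolding w_def L_def by (auto simp: one_le_power)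
  define \<mu> where "\<mu> = spectrum (N * L) N (\<lambda>j. \<Sum>k=1..p. design p j k * \<beta> k)"
  define E where "E = (\<Sum>m=1..N * L. gauss_tail (\<mu> m) t)"
  define Q where "Q = real (N * L) * Psi_bar t"
  define A where "A = E - Q"
  have ex: "2 * w * sqrt Q \<le> A"
    using excess by (simp add: w_def Q_def A_def E_def \<mu>_def sum_subtractf)
  have "1 * 3 \<le> real L * (real N * Psi_bar t)"
    using P L by (intro mult_mono) auto
  then have Q1: "1 \<le> Q" by (simp add: Q_def mult_ac)
  then have sQ: "1 \<le> sqrt Q" by simp
  have "w * 1 \<le> w * sqrt Q" using w1 sQ by (intro mult_left_mono) auto
  then have A2w: "2 * w \<le> A" using ex by linarith
  have "\<P>(y in obs_law p N \<beta>. \<not> ophc_rejects N y) \<le>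
    \<P>(z in noise N. (\<Sum>m=1..N * L. of_bool (t \<le> cmod (spectrum (N * L) N
       (\<lambda>j\<in>{1..N}. (\<Sum>k=1..p. design p j k * \<beta> k) + z j) m))) \<le> Q + w * sqrt Q)"
  proof (rule prob_obs_law_le)
    fix y assume "\<not> ophc_rejects N y"
    then have acc: "(SUP t\<in>{1..sqrt (ln (real N / 3))}. HC (N * L) N y t) \<le> w"
      unfolding ophc_rejects_def HC_star_def w_def L_def by simp
    have bdd: "bdd_above (HC (N * L) N y ` {1..sqrt (ln (real N / 3))})"
    proof (rule bdd_aboveI2)
      fix t' assume t': "t' \<in> {1..sqrt (ln (real N / 3))}"
      have "(\<Sum>m=1..N * L. of_bool (t' \<le> sqrt (periodogram (N * L) N y m))) - real (N * L) * Psi_bar t' \<le> real (N * L)"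
      proof -
        have "(\<Sum>m=1..N * L. of_bool (t' \<le> sqrt (periodogram (N * L) N y m))) \<le> real (card {1..N * L}) * 1"
          by (rule sum_bounded_above) auto
        also have "\<dots> = real (N * L)" by simp
        finally show ?thesis
          using mult_nonneg_nonneg[of "real (N * L)" "Psi_bar t'"] Psi_bar_range(3)[OF N t'] by linarith
      qed
      then have "HC (N * L) N y t' \<le> real (N * L) / sqrt (real (N * L) * Psi_bar t' * (1 - Psi_bar t'))"
        unfolding HC_def using HC_variance_ge[OF N L t'] by (intro divide_right_mono) auto
      also have "\<dots> \<le> real (N * L)"
        using HC_variance_ge[OF N L t'] mult_left_mono[of 1 "sqrt (real (N * L) * Psi_bar t' * (1 - Psi_bar t'))" "real (N * L)"]
        by (subst pos_divide_le_eq) auto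
      finally show "HC (N * L) N y t' \<le> real (N * L)" .
    qed
    have "HC (N * L) N y t \<le> w"
      using cSUP_upper[OF t bdd] acc by linarith
    then have "(\<Sum>m=1..N * L. of_bool (t \<le> cmod (spectrum (N * L) N y m))) - Q \<le>
        w * sqrt (real (N * L) * Psi_bar t * (1 - Psi_bar t))"
      unfolding HC_def sqrt_periodogram Q_def using HC_variance_ge[OF N L t]
      by (subst (asm) pos_divide_le_eq) auto
    also have "\<dots> \<le> w * sqrt Q"
      unfolding Q_def using P w1 by (intro mult_left_mono real_sqrt_le_mono mult_left_le) auto
    finally show "(\<Sum>m=1..N * L. of_bool (t \<le> cmod (spectrum (N * L) N y m))) \<le> Q + w * sqrt Q"
      by simp
  qed measurable
  also have "\<dots> = \<P>(z in noise N. (\<Sum>m=1..N * L. of_bool (t \<le> cmod (\<mu> m + spectrum (N * L) N z m))) \<le> Q + w * sqrt Q)"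
    unfolding spectrum_shift \<mu>_def ..
  also have "\<dots> \<le> real L * E / (E - (Q + w * sqrt Q))\<^sup>2"
    unfolding E_def using ex A2w w1 sQ by (intro count_lower_tail L) (auto simp: A_def E_def)
  also have "\<dots> \<le> real L * E / (A / 2)\<^sup>2"
  proof (rule divide_left_mono)
    have le: "A / 2 \<le> E - (Q + w * sqrt Q)" using ex by (simp add: A_def)
    show "(A / 2)\<^sup>2 \<le> (E - (Q + w * sqrt Q))\<^sup>2"
      using le A2w w1 by (intro power_mono) auto
    show "0 \<le> real L * E" using A2w w1 Q1 by (simp add: A_def)
    show "0 < (E - (Q + w * sqrt Q))\<^sup>2 * (A / 2)\<^sup>2"
      using le A2w w1 by (intro mult_pos_pos) auto
  qed
  also have "\<dots> = 4 * real L * (Q / A\<^sup>2 + 1 / A)"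
  proof -
    have "E = Q + A" by (simp add: A_def)
    then show ?thesis using A2w w1 by (simp add: field_simps power2_eq_square)
  qed
  also have "\<dots> \<le> 4 * real L * (1 / (4 * w) + 1 / w)"
  proof (intro mult_left_mono add_mono)
    have "Q = (sqrt Q)\<^sup>2" using Q1 by simp
    also have "\<dots> \<le> (A / (2 * w))\<^sup>2"
      using ex w1 sQ by (intro power_mono) (auto simp: field_simps)
    finally have "Q / A\<^sup>2 \<le> (A / (2 * w))\<^sup>2 / A\<^sup>2" by (intro divide_right_mono) auto
    also have "\<dots> = 1 / (4 * (w * w))" using A2w w1 by (simp add: power_divide power2_eq_square)
    also have "\<dots> \<le> 1 / (4 * w)" using w1 mult_left_mono[of 1 w w] by (intro divide_left_mono) auto
    finally show "Q / A\<^sup>2 \<le> 1 / (4 * w)" .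
    show "1 / A \<le> 1 / w" using A2w w1 by (intro divide_left_mono) auto
  qed auto
  also have "\<dots> = 5 * real L / w" by (simp add: field_simps)
  finally show ?thesis by (simp add: w_def)
qed

section \<open>The mean spectrum of a separated signal\<close>

text \<open>
  The Dirichlet kernel, normalised to be 1 at 0.
\<close>

definition dirichlet :: "nat \<Rightarrow> real \<Rightarrow> complex" where
  "dirichlet N \<theta> = (\<Sum>j<N. cis (2 * pi * \<theta>) ^ j) / of_nat N"

lemma norm_cis_diff_1: "cmod (cis x - 1) = 2 * \<bar>sin (x / 2)\<bar>"
  using dist_exp_i_1[of x] by (simp add: cis_conv_exp)

lemma dirichlet_near_0:
  assumes N: "0 < N"
  shows "cmod (dirichlet N \<theta> - 1) \<le> 2 * pi * real N * \<bar>\<theta>\<bar>"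
proof -
  have "dirichlet N \<theta> - 1 = (\<Sum>j<N. cis (2 * pi * \<theta>) ^ j - 1) / of_nat N"
    using N by (simp add: dirichlet_def sum_subtractf field_simps)
  then have "cmod (dirichlet N \<theta> - 1) = cmod (\<Sum>j<N. cis (2 * pi * \<theta>) ^ j - 1) / real N"
    by (simp add: norm_divide)
  also have "\<dots> \<le> (\<Sum>j<N. 2 * pi * real N * \<bar>\<theta>\<bar>) / real N"
  proof (intro divide_right_mono sum_norm_le)
    fix j assume j: "j \<in> {..<N}"
    have "cmod (cis (2 * pi * \<theta>) ^ j - 1) = 2 * \<bar>sin (real j * (2 * pi * \<theta>) / 2)\<bar>"
      unfolding Complex.DeMoivre norm_cis_diff_1 ..
    also have "\<dots> \<le> 2 * \<bar>real j * (2 * pi * \<theta>) / 2\<bar>"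
      by (intro mult_left_mono abs_sin_x_le_abs_x) auto
    also have "\<dots> = real j * (2 * pi * \<bar>\<theta>\<bar>)" by (simp add: abs_mult)
    also have "\<dots> \<le> real N * (2 * pi * \<bar>\<theta>\<bar>)" using j by (intro mult_right_mono) auto
    finally show "cmod (cis (2 * pi * \<theta>) ^ j - 1) \<le> 2 * pi * real N * \<bar>\<theta>\<bar>" by (simp add: mult_ac)
  qed simp
  also have "\<dots> = 2 * pi * real N * \<bar>\<theta>\<bar>" using N by simp
  finally show ?thesis .
qed

text \<open>
  A weak form of Jordan's inequality, sufficient below because \<open>\<pi> / 3 \<ge> 1\<close>.
\<close>

lemma sin_ge_third:
  assumes "0 \<le> x" "x \<le> pi / 2"
  shows "x / 3 \<le> sin x"
proof (cases "x \<le> pi / 3")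
  case True
  show ?thesis
  proof (cases "x = 0")
    case False
    then obtain z where z: "0 < z" "z < x" "sin x - sin 0 = (x - 0) * cos z"
      using assms MVT2[of 0 x sin cos] by (auto intro: DERIV_sin)
    have "cos (pi / 3) \<le> cos z"
      using z True by (intro cos_monotone_0_pi_le) auto
    then have "x * (1 / 2) \<le> x * cos z" using assms by (intro mult_left_mono) (auto simp: cos_60)
    then show ?thesis using z assms by simp
  qed simp
next
  case False
  have "x / 3 \<le> 2 / 3" using assms pi_less_4 by simp
  also have "\<dots> \<le> sqrt 3 / 2"
  proof -
    have "4 / 3 \<le> sqrt (3 :: real)" by (rule real_le_rsqrt) (simp add: power2_eq_square)
    then show ?thesis by simp
  qed
  also have "\<dots> = sin (pi / 3)" by (simp add: sin_60)
  also have "\<dots> \<le> sin x" using False assms by (intro sin_monotone_2pi_le) auto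
  finally show ?thesis .
qed

text \<open>
  The kernel is a geometric sum; its denominator is \<open>2 \<bar>sin (\<pi> \<theta>)\<bar>\<close>, and \<open>\<eta>\<close> bounds the distance of \<open>\<theta>\<close> to the
  nearest integer from below.
\<close>

lemma dirichlet_away_from_0:
  assumes N: "0 < N" and \<eta>: "0 < \<eta>" "\<eta> \<le> \<bar>\<theta>\<bar>" "\<bar>\<theta>\<bar> \<le> 1 - \<eta>"
  shows "cmod (dirichlet N \<theta>) \<le> 1 / (real N * \<eta>)"
proof -
  have "\<eta> \<le> sin (pi * \<bar>\<theta>\<bar>)"
  proof (cases "\<bar>\<theta>\<bar> \<le> 1 / 2")
    case True
    have "\<eta> * 1 \<le> \<bar>\<theta>\<bar> * (pi / 3)" using \<eta> pi_gt3 by (intro mult_mono) auto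
    also have "\<dots> = pi * \<bar>\<theta>\<bar> / 3" by simp
    also have "\<dots> \<le> sin (pi * \<bar>\<theta>\<bar>)" using True by (intro sin_ge_third) auto
    finally show ?thesis by simp
  next
    case False
    have "\<eta> * 1 \<le> (1 - \<bar>\<theta>\<bar>) * (pi / 3)" using \<eta> pi_gt3 by (intro mult_mono) auto
    also have "\<dots> = pi * (1 - \<bar>\<theta>\<bar>) / 3" by simp
    also have "\<dots> \<le> sin (pi * (1 - \<bar>\<theta>\<bar>))"
      using False \<eta> by (intro sin_ge_third) (auto simp: mult_le_cancel_left)
    also have "\<dots> = sin (pi * \<bar>\<theta>\<bar>)" by (simp add: right_diff_distrib sin_diff)
    finally show ?thesis by simp
  qed
  also have "\<dots> \<le> \<bar>sin (pi * \<theta>)\<bar>" by (cases "0 \<le> \<theta>") auto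
  finally have den: "2 * \<eta> \<le> cmod (cis (2 * pi * \<theta>) - 1)" by (simp add: norm_cis_diff_1)
  then have ne: "cis (2 * pi * \<theta>) \<noteq> 1" using \<eta> by auto
  have "cmod (dirichlet N \<theta>) = cmod (cis (2 * pi * \<theta>) ^ N - 1) / cmod (cis (2 * pi * \<theta>) - 1) / real N"
    using ne by (simp add: dirichlet_def norm_divide norm_mult geometric_sum)
  also have "\<dots> \<le> 2 / (2 * \<eta>) / real N"
  proof (intro divide_right_mono frac_le)
    show "cmod (cis (2 * pi * \<theta>) ^ N - 1) \<le> 2"
      using norm_triangle_ineq4[of "cis (2 * pi * \<theta>) ^ N" 1] by (simp add: norm_power)
  qed (use den \<eta> in auto)
  finally show ?thesis using \<eta> N by (simp add: mult.commute)
qed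

text \<open>
  Multiplying a row of the transform with a column of the design leaves a pure oscillation at the difference
  of the two frequencies; its sum over the observations is a Dirichlet kernel.
\<close>

lemma spectrum_design_signal:
  assumes p: "0 < p" and N: "0 < N" and \<tau>: "\<tau> \<in> {1..s} \<rightarrow> {1..p}"
  shows "spectrum q N (\<lambda>j. \<Sum>k=1..p. design p j k * signal s \<tau> b k) m =
    of_real (sqrt (real N / real p)) *
      (\<Sum>l=1..s. b l * dirichlet N ((real m - 1) / real q - (real (\<tau> l) - 1) / real p))"
proof -
  let ?\<theta> = "\<lambda>k. (real m - 1) / real q - (real k - 1) / real p"
  have mean: "(\<Sum>k=1..p. design p j k * signal s \<tau> b k) = (\<Sum>l=1..s. design p j (\<tau> l) * b l)" for j
  proof -
    have "(\<Sum>k=1..p. design p j k * signal s \<tau> b k) =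
        (\<Sum>k=1..p. \<Sum>l=1..s. if \<tau> l = k then design p j (\<tau> l) * b l else 0)"
      unfolding signal_def sum.inter_filter[OF finite_atLeastAtMost] sum_distrib_left
      by (intro sum.cong refl) auto
    also have "\<dots> = (\<Sum>l=1..s. design p j (\<tau> l) * b l)"
      using \<tau> by (subst sum.swap) (auto intro!: sum.cong simp: Pi_iff)
    finally show ?thesis .
  qed
  have entry: "oversampled_dft q N m (Suc j) * design p (Suc j) k =
      of_real (1 / (sqrt (real N) * sqrt (real p))) * cis (2 * pi * ?\<theta> k) ^ j" for j k
  proof -
    let ?A = "2 * of_real pi * \<i> * (of_nat m - 1) * (of_nat (Suc j) - 1) / of_nat q :: complex"
    let ?B = "- 2 * of_real pi * \<i> * (of_nat k - 1) * (of_nat (Suc j) - 1) / of_nat p :: complex"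
    have "oversampled_dft q N m (Suc j) * design p (Suc j) k =
        of_real (1 / (sqrt (real N) * sqrt (real p))) * exp (?A + ?B)"
      unfolding oversampled_dft_def design_def exp_add by simp
    also have "?A + ?B = \<i> * of_real (real j * (2 * pi * ?\<theta> k))"
      by (simp add: algebra_simps diff_divide_distrib)
    finally show ?thesis
      unfolding Complex.DeMoivre unfolding cis_conv_exp .
  qed
  have col: "(\<Sum>j=1..N. oversampled_dft q N m j * design p j k) =
      of_real (sqrt (real N / real p)) * dirichlet N (?\<theta> k)" for k
  proof -
    have "(\<Sum>j=1..N. oversampled_dft q N m j * design p j k) =
        (\<Sum>j<N. of_real (1 / (sqrt (real N) * sqrt (real p))) * cis (2 * pi * ?\<theta> k) ^ j)"
      unfolding entry[symmetric] by (rule sum.reindex_bij_witness[of _ Suc "\<lambda>m. m - 1"]) auto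
    also have "\<dots> = of_real (real N / (sqrt (real N) * sqrt (real p))) * dirichlet N (?\<theta> k)"
      unfolding dirichlet_def sum_distrib_left[symmetric] using N by simp
    also have "real N / (sqrt (real N) * sqrt (real p)) = sqrt (real N / real p)"
      using N p by (simp add: real_sqrt_divide field_simps)
    finally show ?thesis .
  qed
  have "spectrum q N (\<lambda>j. \<Sum>k=1..p. design p j k * signal s \<tau> b k) m =
      (\<Sum>j=1..N. \<Sum>l=1..s. b l * (oversampled_dft q N m j * design p j (\<tau> l)))"
    unfolding spectrum_def mean by (simp add: sum_distrib_left mult_ac)
  also have "\<dots> = (\<Sum>l=1..s. b l * (\<Sum>j=1..N. oversampled_dft q N m j * design p j (\<tau> l)))"
    by (subst sum.swap) (simp add: sum_distrib_left)
  also have "\<dots> = of_real (sqrt (real N / real p)) * (\<Sum>l=1..s. b l * dirichlet N (?\<theta> (\<tau> l)))"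
    unfolding col by (simp add: sum_distrib_left mult_ac)
  finally show ?thesis .
qed

lemma harm_le_1_plus_ln:
  assumes "0 < n"
  shows "harm n \<le> 1 + ln (real n)"
proof -
  obtain m where m: "n = Suc m" using assms by (cases n) auto
  have "harm (Suc m) - ln (real (Suc m)) \<le> harm (Suc 0) - ln (real (Suc 0))"
    using decseq_harm_diff_ln unfolding decseq_def by blast
  then show ?thesis by (simp add: m harm_def)
qed

text \<open>
  Each index distance \<open>k\<close> occurs at most twice, and the two summands give the same harmonic sum.
\<close>

lemma sum_cyclic_inverse_distances_le:
  fixes l s :: nat
  assumes l: "l \<in> {1..s}"
  shows "(\<Sum>l'\<in>{1..s} - {l}. 1 / \<bar>real l - real l'\<bar> + 1 / (real s - \<bar>real l - real l'\<bar>)) \<le> 4 * harm s"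
proof -
  define g where "g k = 1 / real k + 1 / (real s - real k)" for k
  have g0: "0 \<le> g k" if "k \<in> {1..<s}" for k using that by (auto simp: g_def)
  have "(\<Sum>l'\<in>{1..s} - {l}. 1 / \<bar>real l - real l'\<bar> + 1 / (real s - \<bar>real l - real l'\<bar>)) =
      (\<Sum>l'\<in>{1..<l}. g (l - l')) + (\<Sum>l'\<in>{l<..s}. g (l' - l))"
  proof -
    have split: "{1..s} - {l} = {1..<l} \<union> {l<..s}" using l by auto
    show ?thesis unfolding split
      by (subst sum.union_disjoint) (auto simp: g_def of_nat_diff intro!: arg_cong2[where f = "(+)"] sum.cong)
  qed
  also have "(\<Sum>l'\<in>{1..<l}. g (l - l')) = (\<Sum>k\<in>{1..<l}. g k)"
    by (rule sum.reindex_bij_witness[of _ "\<lambda>k. l - k" "\<lambda>k. l - k"]) auto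
  also have "\<dots> \<le> (\<Sum>k\<in>{1..<s}. g k)" using l g0 by (intro sum_mono2) auto
  also have "(\<Sum>l'\<in>{l<..s}. g (l' - l)) = (\<Sum>k\<in>{1..s - l}. g k)"
    by (rule sum.reindex_bij_witness[of _ "\<lambda>k. l + k" "\<lambda>k. k - l"]) auto
  also have "\<dots> \<le> (\<Sum>k\<in>{1..<s}. g k)" using l g0 by (intro sum_mono2) auto
  also have "(\<Sum>k\<in>{1..<s}. g k) = (\<Sum>k\<in>{1..<s}. 1 / real k) + (\<Sum>k\<in>{1..<s}. 1 / real (s - k))"
    unfolding g_def sum.distrib by (auto simp: of_nat_diff intro!: arg_cong2[where f = "(+)"] sum.cong)
  also have "(\<Sum>k\<in>{1..<s}. 1 / real (s - k)) = (\<Sum>k\<in>{1..<s}. 1 / real k)"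
    by (rule sum.reindex_bij_witness[of _ "\<lambda>k. s - k" "\<lambda>k. s - k"]) auto
  also have "(\<Sum>k\<in>{1..<s}. 1 / real k) \<le> harm s"
    unfolding harm_def by (auto simp: inverse_eq_divide intro!: sum_mono2)
  finally show ?thesis by simp
qed

text \<open>
  The upper bound comes from adding up the gaps on the complementary arc of the circle, the gap from
  \<open>\<tau> s\<close> to \<open>\<tau> 1 + p\<close> included.
\<close>

lemma param_space_gaps:
  assumes param: "(\<tau>, b) \<in> param_space p N s r" and p: "0 < p" and l: "l \<in> {1..s}" "l' \<in> {1..s}" "l < l'"
  defines "d \<equiv> (ln (real N))\<^sup>2 / real N"
  shows "d * real (l' - l) \<le> (real (\<tau> l') - real (\<tau> l)) / real p"
    and "(real (\<tau> l') - real (\<tau> l)) / real p \<le> 1 - d * (real s - real (l' - l))"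
proof -
  have \<tau>: "\<tau> \<in> {1..s} \<rightarrow>\<^sub>E {1..p}" "strict_mono_on {1..s} \<tau>" and sep: "d \<le> min_sep p s \<tau>"
    using param by (auto simp: param_space_def d_def)
  have gap: "d * real p \<le> \<bar>real (cyc_ext p s \<tau> (i + 1)) - real (cyc_ext p s \<tau> i)\<bar>" if "i \<in> {1..s}" for i
  proof -
    have "d * real p \<le> Min ((\<lambda>l. \<bar>real (cyc_ext p s \<tau> (l + 1)) - real (cyc_ext p s \<tau> l)\<bar>) ` {1..s})"
      using sep p by (simp add: min_sep_def field_simps)
    also have "\<dots> \<le> \<bar>real (cyc_ext p s \<tau> (i + 1)) - real (cyc_ext p s \<tau> i)\<bar>"
      using that by (intro Min_le) auto
    finally show ?thesis .
  qed
  have step: "d * real p \<le> real (\<tau> (i + 1)) - real (\<tau> i)" if "1 \<le> i" "i < s" for i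
  proof -
    have "\<tau> i < \<tau> (i + 1)" using that by (intro strict_mono_onD[OF \<tau>(2)]) auto
    then show ?thesis using gap[of i] that by (simp add: cyc_ext_def)
  qed
  have wrap: "d * real p \<le> real (\<tau> 1) + real p - real (\<tau> s)"
  proof -
    have "\<tau> s \<in> {1..p}" using \<tau>(1) l by (auto simp: PiE_iff)
    then show ?thesis using gap[of s] l by (simp add: cyc_ext_def)
  qed
  have tele: "d * real p * real k \<le> real (\<tau> (i + k)) - real (\<tau> i)" if "1 \<le> i" "i + k \<le> s" for i k
    using that
  proof (induction k)
    case (Suc k)
    then show ?case using step[of "i + k"] by (simp add: algebra_simps)
  qed simp
  have "d * real p * real (l' - l) \<le> real (\<tau> l') - real (\<tau> l)"
    using tele[of l "l' - l"] l by simp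
  then show "d * real (l' - l) \<le> (real (\<tau> l') - real (\<tau> l)) / real p"
    using p by (simp add: field_simps)
  have "d * real p * real (l - 1) \<le> real (\<tau> l) - real (\<tau> 1)"
    using tele[of 1 "l - 1"] l by simp
  moreover have "d * real p * real (s - l') \<le> real (\<tau> s) - real (\<tau> l')"
    using tele[of l' "s - l'"] l by simp
  ultimately have "real (\<tau> l') - real (\<tau> l) \<le> real p - d * real p * (1 + real (l - 1) + real (s - l'))"
    using wrap by (simp add: algebra_simps)
  also have "1 + real (l - 1) + real (s - l') = real s - real (l' - l)"
    using l by (simp add: of_nat_diff)
  finally show "(real (\<tau> l') - real (\<tau> l)) / real p \<le> 1 - d * (real s - real (l' - l))"
    using p by (simp add: field_simps)
qed

text \<open>
  The index of the last grid frequency \<open>(m - 1) / q\<close> that does not exceed \<open>(k - 1) / p\<close>. Rounding down, rather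
  than to the nearest frequency, keeps the index in \<open>{1..q}\<close>.
\<close>

definition bin_below :: "nat \<Rightarrow> nat \<Rightarrow> nat \<Rightarrow> nat" where
  "bin_below p q k = nat \<lfloor>(real k - 1) * real q / real p\<rfloor> + 1"

lemma bin_below_bounds:
  assumes "0 < p" "0 < q" "k \<in> {1..p}"
  shows "bin_below p q k \<in> {1..q}"
    and "(real (bin_below p q k) - 1) / real q \<le> (real k - 1) / real p"
    and "(real k - 1) / real p < (real (bin_below p q k) - 1) / real q + 1 / real q"
proof -
  let ?x = "(real k - 1) * real q / real p"
  have x0: "0 \<le> ?x" using assms by auto
  have "?x < real q" using assms by (simp add: divide_less_eq)
  then have "nat \<lfloor>?x\<rfloor> < q" using x0 by linarith
  then show "bin_below p q k \<in> {1..q}" by (simp add: bin_below_def)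
  have fl: "real (nat \<lfloor>?x\<rfloor>) \<le> ?x" "?x < real (nat \<lfloor>?x\<rfloor>) + 1" using x0 by linarith+
  have m: "real (bin_below p q k) - 1 = real (nat \<lfloor>?x\<rfloor>)" by (simp add: bin_below_def)
  have x: "?x / real q = (real k - 1) / real p" using assms by simp
  have "real (nat \<lfloor>?x\<rfloor>) / real q \<le> ?x / real q" using fl(1) by (intro divide_right_mono) auto
  then show "(real (bin_below p q k) - 1) / real q \<le> (real k - 1) / real p"
    unfolding m x .
  have "?x / real q < (real (nat \<lfloor>?x\<rfloor>) + 1) / real q"
    using fl(2) assms by (intro divide_strict_right_mono) auto
  then show "(real k - 1) / real p < (real (bin_below p q k) - 1) / real q + 1 / real q"
    unfolding m x add_divide_distrib .
qed

text \<open>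
  Up to a common factor, the mean spectrum at the bin of \<open>\<tau> l\<close> is the value of the own kernel, which is
  within \<open>2 \<pi> / L\<close> of 1, plus the kernels of the other support points. The latter are evaluated at cyclic
  distance at least \<open>d / 2\<close> times their cyclic index distance, so they add up to a harmonic sum
  divided by \<open>(ln N)\<^sup>2\<close>.
\<close>

lemma spectrum_at_bin_below:
  assumes param: "(\<tau>, b) \<in> param_space p N s r"
    and p: "0 < p" and N: "0 < N" and L: "0 < L" and r: "0 \<le> r * ln (real p)"
    and dense: "2 \<le> real L * (ln (real N))\<^sup>2"
  defines "q \<equiv> N * L"
  shows "inj_on (\<lambda>l. bin_below p q (\<tau> l)) {1..s}"
    and "\<And>l. l \<in> {1..s} \<Longrightarrow> bin_below p q (\<tau> l) \<in> {1..q}"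
    and "\<And>l. l \<in> {1..s} \<Longrightarrow>
      sqrt (r * ln (real p)) * (1 - 2 * pi / real L - 8 * harm s / (ln (real N))\<^sup>2) \<le>
      cmod (spectrum q N (\<lambda>j. \<Sum>k=1..p. design p j k * signal s \<tau> b k) (bin_below p q (\<tau> l)))"
proof -
  define d where "d = (ln (real N))\<^sup>2 / real N"
  have q: "0 < q" using N L by (simp add: q_def)
  have dq: "1 / real q \<le> d / 2"
    using dense N L by (simp add: d_def q_def field_simps)
  then have d: "0 < d" using q by (smt (verit) divide_pos_pos of_nat_0_less_iff zero_less_one half_gt_zero_iff)
  have \<tau>: "\<tau> \<in> {1..s} \<rightarrow> {1..p}" and b: "\<And>l. l \<in> {1..s} \<Longrightarrow> cmod (b l) = sqrt (r * real p * ln (real p) / real N)"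
    using param by (auto simp: param_space_def)
  define x where "x l = (real (\<tau> l) - 1) / real p" for l
  define M where "M l = bin_below p q (\<tau> l)" for l
  have M: "M l \<in> {1..q}" "(real (M l) - 1) / real q \<le> x l" "x l < (real (M l) - 1) / real q + 1 / real q"
    if "l \<in> {1..s}" for l
    unfolding M_def x_def using bin_below_bounds[OF p q Pi_mem[OF \<tau> that]] .
  have gap: "d * real (l' - l) \<le> x l' - x l" "x l' - x l \<le> 1 - d * (real s - real (l' - l))"
    if "l \<in> {1..s}" "l' \<in> {1..s}" "l < l'" for l l'
    using param_space_gaps[OF param p that, folded d_def] unfolding x_def
    by (simp_all add: diff_divide_distrib)
  have M_less: "M l < M l'" if "l \<in> {1..s}" "l' \<in> {1..s}" "l < l'" for l l'
  proof -
    have "d * 1 \<le> d * real (l' - l)" using that d by (intro mult_left_mono) auto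
    then have "d \<le> x l' - x l" using gap(1)[OF that] by linarith
    then have "(real (M l) - 1) / real q < (real (M l') - 1) / real q"
      using M(2)[OF that(1)] M(3)[OF that(2)] dq d by linarith
    then show ?thesis using q by (simp add: divide_less_cancel)
  qed
  then show "inj_on (\<lambda>l. bin_below p q (\<tau> l)) {1..s}"
    unfolding M_def[symmetric] by (metis inj_onI linorder_neqE_nat less_irrefl)
  show "bin_below p q (\<tau> l) \<in> {1..q}" if "l \<in> {1..s}" for l
    using M(1)[OF that] by (simp add: M_def)
  fix l assume l: "l \<in> {1..s}"
  define D where "D l' = dirichlet N ((real (M l) - 1) / real q - x l')" for l'
  define B where "B = sqrt (r * real p * ln (real p) / real N)"
  have "0 \<le> (r * ln (real p)) * (real p / real N)" by (rule mult_nonneg_nonneg[OF r]) simp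
  then have B0: "0 \<le> B" by (simp add: B_def mult_ac)
  define w where "w = (ln (real N))\<^sup>2"
  have w: "0 < w" using d by (auto simp: d_def w_def zero_less_divide_iff)
  have main: "1 - 2 * pi / real L \<le> cmod (D l)"
  proof -
    have "\<bar>(real (M l) - 1) / real q - x l\<bar> \<le> 1 / real q" using M(2,3)[OF l] by linarith
    then have "2 * pi * real N * \<bar>(real (M l) - 1) / real q - x l\<bar> \<le> 2 * pi * real N * (1 / real q)"
      by (intro mult_left_mono) auto
    also have "\<dots> = 2 * pi / real L" using N by (simp add: q_def)
    finally have "cmod (D l - 1) \<le> 2 * pi / real L"
      using dirichlet_near_0[OF N, of "(real (M l) - 1) / real q - x l"] unfolding D_def by linarith
    then show ?thesis using norm_triangle_ineq2[of 1 "1 - D l"] by (simp add: norm_minus_commute)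
  qed
  have cross: "cmod (D l') \<le> 2 / w * (1 / \<bar>real l - real l'\<bar> + 1 / (real s - \<bar>real l - real l'\<bar>))"
    if l': "l' \<in> {1..s} - {l}" for l'
  proof -
    define k where "k = \<bar>real l - real l'\<bar>"
    have k: "1 \<le> k" "1 \<le> real s - k" using l l' by (auto simp: k_def)
    have x: "d * k \<le> \<bar>x l - x l'\<bar>" "\<bar>x l - x l'\<bar> \<le> 1 - d * (real s - k)"
    proof -
      have "d * k \<le> \<bar>x l - x l'\<bar> \<and> \<bar>x l - x l'\<bar> \<le> 1 - d * (real s - k)"
      proof (cases "l < l'")
        case True
        then have "real (l' - l) = k" by (simp add: k_def of_nat_diff)
        moreover have "0 \<le> d * k" using d k by simp
        ultimately show ?thesis using gap[of l l'] l l' True by auto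
      next
        case False
        then have "l' < l" "real (l - l') = k" using l' by (auto simp: k_def of_nat_diff)
        moreover have "0 \<le> d * k" using d k by simp
        ultimately show ?thesis using gap[of l' l] l l' by auto
      qed
      then show "d * k \<le> \<bar>x l - x l'\<bar>" "\<bar>x l - x l'\<bar> \<le> 1 - d * (real s - k)" by auto
    qed
    define \<theta> where "\<theta> = (real (M l) - 1) / real q - x l'"
    have \<theta>: "\<bar>\<theta> - (x l - x l')\<bar> \<le> d / 2"
      using M(2,3)[OF l] dq unfolding \<theta>_def by linarith
    \<comment> \<open>The rounding error of the bin is at most half a gap \<open>d\<close>, hence the factor 1/2.\<close>
    define \<eta> where "\<eta> = d / 2 * min k (real s - k)"
    have "d / 2 * 1 \<le> d / 2 * k" "d / 2 * 1 \<le> d / 2 * (real s - k)" using k d by (auto intro!: mult_left_mono)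
    moreover have "\<eta> \<le> d / 2 * k" "\<eta> \<le> d / 2 * (real s - k)"
      using d by (auto simp: \<eta>_def intro!: mult_left_mono)
    moreover have "d * k = d / 2 * k + d / 2 * k" "d * (real s - k) = d / 2 * (real s - k) + d / 2 * (real s - k)"
      by simp_all
    ultimately have "\<eta> \<le> \<bar>\<theta>\<bar>" "\<bar>\<theta>\<bar> \<le> 1 - \<eta>" using x \<theta> by linarith+
    moreover have "0 < \<eta>" using d k by (simp add: \<eta>_def)
    ultimately have "cmod (D l') \<le> 1 / (real N * \<eta>)"
      unfolding D_def \<theta>_def[symmetric] by (intro dirichlet_away_from_0 N)
    also have "real N * \<eta> = w / 2 * min k (real s - k)" using N by (simp add: \<eta>_def d_def w_def)
    also have "1 / (w / 2 * min k (real s - k)) = 2 / w * (1 / min k (real s - k))" by simp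
    also have "\<dots> \<le> 2 / w * (1 / k + 1 / (real s - k))"
      using w k by (intro mult_left_mono) (auto simp: min_def)
    finally show ?thesis by (simp add: k_def)
  qed
  have interference: "cmod (\<Sum>l'\<in>{1..s} - {l}. b l' * D l') \<le> B * (8 * harm s / w)"
  proof -
    have "cmod (\<Sum>l'\<in>{1..s} - {l}. b l' * D l') \<le>
        (\<Sum>l'\<in>{1..s} - {l}. B * (2 / w * (1 / \<bar>real l - real l'\<bar> + 1 / (real s - \<bar>real l - real l'\<bar>))))"
    proof (rule sum_norm_le)
      fix l' assume l': "l' \<in> {1..s} - {l}"
      then have "cmod (b l') = B" using b by (simp add: B_def)
      then show "cmod (b l' * D l') \<le>
          B * (2 / w * (1 / \<bar>real l - real l'\<bar> + 1 / (real s - \<bar>real l - real l'\<bar>)))"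
        using mult_left_mono[OF cross[OF l'] B0] by (simp only: norm_mult)
    qed
    also have "\<dots> = B * (2 / w) * (\<Sum>l'\<in>{1..s} - {l}. 1 / \<bar>real l - real l'\<bar> + 1 / (real s - \<bar>real l - real l'\<bar>))"
      by (simp add: sum_distrib_left mult_ac)
    also have "\<dots> \<le> B * (2 / w) * (4 * harm s)"
      using w B0 by (intro mult_left_mono sum_cyclic_inverse_distances_le l) auto
    finally show ?thesis by (simp add: mult_ac)
  qed
  have "B * (1 - 2 * pi / real L - 8 * harm s / w) \<le> B * cmod (D l) - B * (8 * harm s / w)"
  proof -
    have "B * (1 - 2 * pi / real L) \<le> B * cmod (D l)"
      using main B0 by (intro mult_left_mono) auto
    then show ?thesis by (simp add: algebra_simps)
  qed
  also have "\<dots> \<le> cmod (b l * D l) - cmod (\<Sum>l'\<in>{1..s} - {l}. b l' * D l')"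
    using interference b[OF l] by (simp add: norm_mult B_def)
  also have "\<dots> \<le> cmod (\<Sum>l'=1..s. b l' * D l')"
    unfolding sum.remove[OF finite_atLeastAtMost l] by (rule norm_diff_ineq)
  finally have low: "B * (1 - 2 * pi / real L - 8 * harm s / w) \<le> cmod (\<Sum>l'=1..s. b l' * D l')" .
  have "sqrt (r * ln (real p)) = sqrt (real N / real p) * B"
    using N p by (simp add: B_def flip: real_sqrt_mult)
  then have "sqrt (r * ln (real p)) * (1 - 2 * pi / real L - 8 * harm s / w) =
      sqrt (real N / real p) * (B * (1 - 2 * pi / real L - 8 * harm s / w))" by simp
  also have "\<dots> \<le> sqrt (real N / real p) * cmod (\<Sum>l'=1..s. b l' * D l')"
    by (intro mult_left_mono low) auto
  also have "\<dots> = cmod (spectrum q N (\<lambda>j. \<Sum>k=1..p. design p j k * signal s \<tau> b k) (M l))"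
    unfolding spectrum_design_signal[OF p N \<tau>] D_def x_def by (simp add: norm_mult)
  finally show "sqrt (r * ln (real p)) * (1 - 2 * pi / real L - 8 * harm s / (ln (real N))\<^sup>2) \<le>
      cmod (spectrum q N (\<lambda>j. \<Sum>k=1..p. design p j k * signal s \<tau> b k) (bin_below p q (\<tau> l)))"
    by (simp add: M_def w_def)
qed

section \<open>Exponents and asymptotics\<close>

text \<open>
  For fixed \<open>\<rho>\<close>, the difference of the two sides of the last inequality is largest at \<open>c = 4 \<rho>\<close>, the choice made when
  \<open>\<sigma> > 1 / 4\<close> and \<open>r < 1 / 4\<close>. Otherwise \<open>c\<close> is taken slightly below 1, where the levels \<open>sqrt (c * ln N)\<close> reach the
  end of the range of thresholds; this needs only \<open>1 - sqrt \<rho> < sqrt \<sigma>\<close>.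
\<close>

lemma exponents_exist:
  fixes \<sigma> r :: real
  assumes \<sigma>: "0 < \<sigma>" "\<sigma> < 1 / 2"
    and r: "(if \<sigma> \<le> 1 / 4 then (1 - sqrt \<sigma>)\<^sup>2 else 1 / 2 - \<sigma>) < r"
  obtains c \<rho> where "0 < c" "c < 1" "0 < \<rho>" "\<rho> < r"
    "(max 0 (sqrt c - sqrt \<rho>))\<^sup>2 < c" "(1 - c) / 2 < \<sigma> - (max 0 (sqrt c - sqrt \<rho>))\<^sup>2"
proof (cases "\<sigma> > 1 / 4 \<and> r < 1 / 4")
  case True
  then obtain \<rho> where \<rho>: "1 / 2 - \<sigma> < \<rho>" "\<rho> < r" using r dense[of "1 / 2 - \<sigma>" r] by auto
  have \<rho>0: "0 < \<rho>" using \<rho> \<sigma> by linarith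
  have "sqrt (4 * \<rho>) - sqrt \<rho> = sqrt \<rho>" by (simp add: real_sqrt_mult)
  then have x0: "(max 0 (sqrt (4 * \<rho>) - sqrt \<rho>))\<^sup>2 = \<rho>" using \<rho>0 by simp
  show ?thesis
  proof (rule that[of "4 * \<rho>" \<rho>])
    show "(max 0 (sqrt (4 * \<rho>) - sqrt \<rho>))\<^sup>2 < 4 * \<rho>"
      "(1 - 4 * \<rho>) / 2 < \<sigma> - (max 0 (sqrt (4 * \<rho>) - sqrt \<rho>))\<^sup>2"
      unfolding x0 using \<rho> \<rho>0 by (simp_all add: field_simps)
  qed (use \<rho> \<rho>0 True in auto)
next
  case False
  have s1: "sqrt \<sigma> < 1" using \<sigma> by simp
  have "(1 - sqrt \<sigma>)\<^sup>2 < r"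
  proof (cases "\<sigma> \<le> 1 / 4")
    case f: False
    have "1 / 2 < sqrt \<sigma>" using f by (intro real_less_rsqrt) (simp add: power2_eq_square)
    then have "(1 - sqrt \<sigma>)\<^sup>2 < (1 / 2)\<^sup>2" using s1 by (intro power_strict_mono) auto
    then show ?thesis using False f by (simp add: power2_eq_square)
  qed (use r in simp)
  then obtain \<rho> where \<rho>: "(1 - sqrt \<sigma>)\<^sup>2 < \<rho>" "\<rho> < r" using dense by blast
  have \<rho>0: "0 < \<rho>" using \<rho>(1) zero_le_power2[of "1 - sqrt \<sigma>"] by linarith
  have s\<rho>: "1 - sqrt \<sigma> < sqrt \<rho>" using \<rho>(1) by (rule real_less_rsqrt)
  define x1 where "x1 = max 0 (1 - sqrt \<rho>)"
  have "x1 < sqrt \<sigma>" using s\<rho> \<sigma> by (simp add: x1_def)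
  moreover have "0 \<le> x1" by (simp add: x1_def)
  ultimately have "x1\<^sup>2 < (sqrt \<sigma>)\<^sup>2" by (intro power_strict_mono) auto
  then have x1: "x1\<^sup>2 < \<sigma>" using \<sigma> by simp
  define c where "c = 1 - (\<sigma> - x1\<^sup>2)"
  have c: "0 < c" "c < 1" using x1 \<sigma> zero_le_power2[of x1] unfolding c_def by linarith+
  define x0 where "x0 = max 0 (sqrt c - sqrt \<rho>)"
  have "sqrt c \<le> 1" using c by simp
  then have "x0 \<le> x1" "0 \<le> x0" unfolding x0_def x1_def by linarith+
  then have "x0\<^sup>2 \<le> x1\<^sup>2" by (rule power_mono)
  then have 1: "(1 - c) / 2 < \<sigma> - x0\<^sup>2" using x1 by (simp add: c_def field_simps)
  have "x0\<^sup>2 < (sqrt c)\<^sup>2" using c \<rho>0 by (intro power_strict_mono) (auto simp: x0_def)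
  then have 2: "x0\<^sup>2 < c" using c by simp
  show ?thesis
    by (rule that[of c \<rho>]) (use c \<rho>0 \<rho> 1 2 in \<open>auto simp: x0_def\<close>)
qed

lemma detection_boundary_rescaled:
  assumes "0 \<le> \<gamma>" "\<gamma> < 1" "\<alpha> < 1" and r: "detection_boundary \<gamma> \<alpha> < r"
  defines "\<sigma> \<equiv> (1 - \<alpha>) / (1 - \<gamma>)"
  shows "(if \<sigma> \<le> 1 / 4 then (1 - sqrt \<sigma>)\<^sup>2 else 1 / 2 - \<sigma>) < r / (1 - \<gamma>)"
proof -
  have iff: "3 / 4 + \<gamma> / 4 \<le> \<alpha> \<longleftrightarrow> \<sigma> \<le> 1 / 4"
    using assms by (auto simp: field_simps)
  have sq: "(sqrt (1 - \<gamma>) - sqrt (1 - \<alpha>))\<^sup>2 / (1 - \<gamma>) = (1 - sqrt \<sigma>)\<^sup>2"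
  proof -
    have "(sqrt (1 - \<gamma>) - sqrt (1 - \<alpha>))\<^sup>2 / (1 - \<gamma>) = ((sqrt (1 - \<gamma>) - sqrt (1 - \<alpha>)) / sqrt (1 - \<gamma>))\<^sup>2"
      using assms by (simp add: power_divide)
    also have "(sqrt (1 - \<gamma>) - sqrt (1 - \<alpha>)) / sqrt (1 - \<gamma>) = 1 - sqrt \<sigma>"
    proof -
      have "sqrt \<sigma> = sqrt (1 - \<alpha>) / sqrt (1 - \<gamma>)" unfolding \<sigma>_def by (rule real_sqrt_divide)
      then show ?thesis using \<open>\<gamma> < 1\<close> by (simp add: diff_divide_distrib)
    qed
    finally show ?thesis .
  qed
  have "detection_boundary \<gamma> \<alpha> / (1 - \<gamma>) < r / (1 - \<gamma>)"
    using r assms by (intro divide_strict_right_mono) auto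
  moreover have "(\<alpha> - 1 / 2 - \<gamma> / 2) / (1 - \<gamma>) = 1 / 2 - \<sigma>"
    using assms by (simp add: \<sigma>_def field_simps)
  ultimately show ?thesis
    using sq iff by (auto simp: detection_boundary_def split: if_splits)
qed

text \<open>
  On the right is a lower bound for the expected excess from \<open>x powr \<sigma>\<close> strong frequencies, on the left the excess
  that is required of it at the level \<open>sqrt (c * ln x)\<close>. In terms of \<open>y = ln x\<close> the two sides differ by the factor
  \<open>exp (\<epsilon> y)\<close> with \<open>\<epsilon> > 0\<close>, against losses of order \<open>exp (O(sqrt y))\<close>.
\<close>

lemma eventually_signal_dominates:
  fixes c \<sigma> x0 :: real
  assumes x0: "0 \<le> x0" "x0 \<le> 1" "x0\<^sup>2 < c" and gap: "(1 - c) / 2 < \<sigma> - x0\<^sup>2"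
  shows "\<forall>\<^sub>F x in at_top. 2 * (ln x)\<^sup>2 * sqrt (x * (ln x + 1) * x powr (- c)) \<le>
    x powr \<sigma> * (exp (- (x0 * sqrt (ln x) + 2)\<^sup>2) - x powr (- c))"
proof -
  define \<epsilon> \<delta> where "\<epsilon> = \<sigma> - x0\<^sup>2 - (1 - c) / 2" and "\<delta> = c - x0\<^sup>2"
  have pos: "0 < \<epsilon>" "0 < \<delta>" using assms by (auto simp: \<epsilon>_def \<delta>_def)
  have "\<forall>\<^sub>F y in at_top. exp (- \<delta> * y) \<le> exp (- 4 * sqrt y - 4) / 2"
    using pos by real_asymp
  moreover have "\<forall>\<^sub>F y in at_top. 2 * y\<^sup>2 * sqrt (y + 1) \<le> exp (\<epsilon> * y - 4 * sqrt y - 4) / 2"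
    using pos by real_asymp
  moreover have "\<forall>\<^sub>F y in at_top. (0::real) < y" by (rule eventually_gt_at_top)
  ultimately have "\<forall>\<^sub>F y in at_top. 2 * y\<^sup>2 * sqrt (exp y * (y + 1) * exp (- c * y)) \<le>
    exp (\<sigma> * y) * (exp (- (x0 * sqrt y + 2)\<^sup>2) - exp (- c * y))"
  proof eventually_elim
    case (elim y)
    have "sqrt (exp y * exp (- c * y)) = exp ((1 - c) / 2 * y)"
      by (rule real_sqrt_unique) (auto simp: power2_eq_square field_simps simp flip: exp_add)
    moreover have "sqrt (exp y * (y + 1) * exp (- c * y)) = sqrt (y + 1) * sqrt (exp y * exp (- c * y))"
      unfolding real_sqrt_mult[symmetric] by (simp add: mult_ac)
    ultimately have "2 * y\<^sup>2 * sqrt (exp y * (y + 1) * exp (- c * y)) =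
        (2 * y\<^sup>2 * sqrt (y + 1)) * exp ((1 - c) / 2 * y)"
      by simp
    also have "\<dots> \<le> (exp (\<epsilon> * y - 4 * sqrt y - 4) / 2) * exp ((1 - c) / 2 * y)"
      using elim by (intro mult_right_mono) auto
    also have "\<dots> = exp ((\<sigma> - x0\<^sup>2) * y) * (exp (- 4 * sqrt y - 4) - exp (- 4 * sqrt y - 4) / 2)"
      by (simp add: \<epsilon>_def field_simps flip: exp_add)
    also have "\<dots> \<le> exp ((\<sigma> - x0\<^sup>2) * y) * (exp (- 4 * x0 * sqrt y - 4) - exp (- \<delta> * y))"
    proof (intro mult_left_mono diff_mono)
      have "x0 * sqrt y \<le> 1 * sqrt y" using x0 elim by (intro mult_right_mono) auto
      then show "exp (- 4 * sqrt y - 4) \<le> exp (- 4 * x0 * sqrt y - 4)" by simp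
    qed (use elim in auto)
    also have "\<dots> = exp (\<sigma> * y) * (exp (- (x0 * sqrt y + 2)\<^sup>2) - exp (- c * y))"
    proof -
      have "(x0 * sqrt y + 2)\<^sup>2 = x0\<^sup>2 * y + 4 * x0 * sqrt y + 4"
        using elim by (simp add: power2_sum power_mult_distrib)
      then show ?thesis by (simp add: \<delta>_def algebra_simps flip: exp_add)
    qed
    finally show ?case .
  qed
  then have "\<forall>\<^sub>F x in at_top. 2 * (ln x)\<^sup>2 * sqrt (exp (ln x) * (ln x + 1) * exp (- c * ln x)) \<le>
    exp (\<sigma> * ln x) * (exp (- (x0 * sqrt (ln x) + 2)\<^sup>2) - exp (- c * ln x))"
    by (rule eventually_compose_filterlim) (rule ln_at_top)
  with eventually_gt_at_top[of 0] show ?thesis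
    by eventually_elim (simp add: powr_def)
qed

lemma oversampling_bounds:
  assumes "1 \<le> N"
  shows "ln (real N) \<le> real (oversampling N)" "real (oversampling N) \<le> ln (real N) + 1"
    "0 < oversampling N"
proof -
  have "0 \<le> ln (real N)" using assms by simp
  then show "ln (real N) \<le> real (oversampling N)" "real (oversampling N) \<le> ln (real N) + 1"
    "0 < oversampling N" by linarith+
qed

text \<open>
  The supremum of the empty set of reals is unspecified, so an estimate of the maximal risk needs a member of the
  parameter space; equally spaced support points are far enough apart.
\<close>

lemma param_space_nonempty:
  assumes s: "0 < s" and p: "0 < p" and Np: "N \<le> p" and N: "3 \<le> N" and r: "0 \<le> r"
    and sparse: "2 * real s * (ln (real N))\<^sup>2 \<le> real N"
  shows "param_space p N s r \<noteq> {}"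
proof -
  define d where "d = p div s"
  define \<tau> where "\<tau> = (\<lambda>l\<in>{1..s}. (l - 1) * d + 1)"
  define b where "b = (\<lambda>l\<in>{1..s}. complex_of_real (sqrt (r * real p * ln (real p) / real N)))"
  have "1 \<le> ln (real N)" using N exp_le by (subst ln_ge_iff) auto
  then have "1 \<le> (ln (real N))\<^sup>2" by (simp add: one_le_power)
  then have "2 * real s * 1 \<le> 2 * real s * (ln (real N))\<^sup>2" by (intro mult_left_mono) auto
  then have sp: "2 * real s \<le> real p" using sparse Np by linarith
  have sd: "s * d \<le> p" by (simp add: d_def)
  have "real p / real s - 1 \<le> real d"
    using floor_divide_of_nat_eq[of p s, where ?'a = real] unfolding d_def by linarith
  moreover have "1 \<le> real p / (2 * real s)" using sp s by (simp add: field_simps)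
  ultimately have d_ge: "real p / (2 * real s) \<le> real d" by (simp add: field_simps)
  then have "0 < real d" using p s by (smt (verit) divide_pos_pos of_nat_0_less_iff mult_pos_pos)
  then have d0: "0 < d" by simp
  have \<tau>_eq: "\<tau> l = (l - 1) * d + 1" if "l \<in> {1..s}" for l using that by (simp add: \<tau>_def)
  have \<tau>_last: "(s - 1) * d + d \<le> p" using sd s by (cases s) (auto simp: add.commute)
  have \<tau>_range: "\<tau> l \<in> {1..p}" if l: "l \<in> {1..s}" for l
  proof -
    have "(l - 1) * d \<le> (s - 1) * d" using l by (intro mult_right_mono) auto
    then have "(l - 1) * d + 1 \<le> p" using \<tau>_last d0 by linarith
    then show ?thesis using \<tau>_eq[OF l] by simp
  qed
  have "(ln (real N))\<^sup>2 / real N \<le> 1 / (2 * real s)"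
    using sparse N s by (simp add: field_simps)
  also have "\<dots> = (real p / (2 * real s)) / real p" using p by simp
  also have "\<dots> \<le> real d / real p" using d_ge by (intro divide_right_mono) auto
  also have "\<dots> \<le> min_sep p s \<tau>"
  proof -
    have "real d \<le> \<bar>real (cyc_ext p s \<tau> (l + 1)) - real (cyc_ext p s \<tau> l)\<bar>" if l: "l \<in> {1..s}" for l
    proof (cases "l = s")
      case True
      have "real ((s - 1) * d + d) \<le> real p" using \<tau>_last by (simp only: of_nat_le_iff)
      then show ?thesis using True l \<tau>_eq[of 1] \<tau>_eq[of s] by (simp add: cyc_ext_def)
    next
      case False
      then have "l * d = (l - 1) * d + d" using l by (cases l) auto
      then show ?thesis using False l \<tau>_eq[of l] \<tau>_eq[of "l + 1"] by (simp add: cyc_ext_def)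
    qed
    then have "real d \<le> Min ((\<lambda>l. \<bar>real (cyc_ext p s \<tau> (l + 1)) - real (cyc_ext p s \<tau> l)\<bar>) ` {1..s})"
      using s by (intro Min.boundedI) auto
    then show ?thesis using p by (simp add: min_sep_def divide_right_mono)
  qed
  finally have "(ln (real N))\<^sup>2 / real N \<le> min_sep p s \<tau>" .
  moreover have "strict_mono_on {1..s} \<tau>"
  proof (rule strict_mono_onI)
    fix k l assume "k \<in> {1..s}" "l \<in> {1..s}" "k < l"
    then show "\<tau> k < \<tau> l" using d0 \<tau>_eq by (auto intro!: mult_strict_right_mono)
  qed
  moreover have "\<tau> \<in> {1..s} \<rightarrow>\<^sub>E {1..p}" using \<tau>_range by (auto simp: PiE_iff \<tau>_def extensional_def)
  moreover have "cmod (b l) = sqrt (r * real p * ln (real p) / real N)" if "l \<in> {1..s}" for l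
  proof -
    have "0 \<le> r * real p * ln (real p) / real N" using r p by (intro divide_nonneg_nonneg mult_nonneg_nonneg) auto
    then show ?thesis using that by (simp add: b_def)
  qed
  ultimately have "(\<tau>, b) \<in> param_space p N s r"
    by (auto simp: param_space_def b_def)
  then show ?thesis by blast
qed

text \<open>
  All frequencies outside the range of \<open>M\<close> are dropped: their excess is nonnegative by \<open>gauss_tail_ge_central\<close>.
\<close>

lemma excess_of_strong_bins:
  fixes \<mu> :: "nat \<Rightarrow> complex" and M :: "nat \<Rightarrow> nat"
  assumes t: "0 \<le> t" and x: "0 \<le> x" and M: "inj_on M {1..s}" "\<And>l. l \<in> {1..s} \<Longrightarrow> M l \<in> {1..q}"
    and strong: "\<And>l. l \<in> {1..s} \<Longrightarrow> t \<le> cmod (\<mu> (M l)) + x"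
  shows "real s * (exp (- (x + 2)\<^sup>2) - Psi_bar t) \<le> (\<Sum>m=1..q. gauss_tail (\<mu> m) t - Psi_bar t)"
proof -
  have "real s * (exp (- (x + 2)\<^sup>2) - Psi_bar t) = (\<Sum>l=1..s. exp (- (x + 2)\<^sup>2) - Psi_bar t)" by simp
  also have "\<dots> \<le> (\<Sum>l=1..s. gauss_tail (\<mu> (M l)) t - Psi_bar t)"
    using strong x by (intro sum_mono diff_mono gauss_tail_ge) auto
  also have "\<dots> = (\<Sum>m\<in>M ` {1..s}. gauss_tail (\<mu> m) t - Psi_bar t)"
    using sum.reindex[OF M(1), of "\<lambda>m. gauss_tail (\<mu> m) t - Psi_bar t"] by simp
  also have "\<dots> \<le> (\<Sum>m=1..q. gauss_tail (\<mu> m) t - Psi_bar t)"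
    using M(2) gauss_tail_ge_central[OF t] by (intro sum_mono2) (auto simp: Psi_bar_def)
  finally show ?thesis .
qed

section \<open>Power of the test\<close>

text \<open>
  The bound does not depend on the parameter \<open>(\<tau>, b)\<close>. The mean reaches \<open>sqrt (\<rho> * ln N)\<close> at the bins of the support, so
  noise of modulus \<open>x0 * sqrt (ln N)\<close> in the right direction lifts it above the level \<open>sqrt (c * ln N)\<close>.
\<close>

lemma uniform_acceptance_le:
  assumes N: "9 \<le> N" "2 \<le> ln (real N)" and p: "0 < p" and s: "0 < s" "s \<le> N"
    and param: "(\<tau>, b) \<in> param_space p N s r"
    and c: "0 < c" "1 \<le> c * ln (real N)" "c * ln (real N) \<le> ln (real N / 3)"
    and rho: "0 \<le> \<rho>" and r: "r * ln (real p) = r' * ln (real N)" "0 \<le> r'"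
    and mean: "sqrt \<rho> \<le> sqrt r' * (1 - 2 * pi / ln (real N) - 8 * (1 + ln (real N)) / (ln (real N))\<^sup>2)"
    and x0: "x0 = max 0 (sqrt c - sqrt \<rho>)"
    and dominates: "2 * (ln (real N))\<^sup>2 * sqrt (real N * (ln (real N) + 1) * real N powr (- c)) \<le>
      real s * (exp (- (x0 * sqrt (ln (real N)) + 2)\<^sup>2) - real N powr (- c))"
  shows "\<P>(y in obs_law p N (signal s \<tau> b). \<not> ophc_rejects N y)
    \<le> 5 * real (oversampling N) / (ln (real N))\<^sup>2"
proof -
  let ?L = "oversampling N"
  let ?\<Lambda> = "ln (real N)"
  have N1: "1 \<le> N" using N by simp
  note L = oversampling_bounds[OF N1]
  define t where "t = sqrt (c * ?\<Lambda>)"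
  have t: "t \<in> {1..sqrt (ln (real N / 3))}" using c by (simp add: t_def)
  have Psi: "Psi_bar t = real N powr (- c)"
    using N c by (simp add: Psi_bar_def t_def powr_def)
  have dense: "2 \<le> real ?L * ?\<Lambda>\<^sup>2"
  proof -
    have "2 * 1 \<le> ?\<Lambda> * ?\<Lambda>" using N by (intro mult_mono) auto
    then have "1 * 2 \<le> real ?L * ?\<Lambda>\<^sup>2" using L(3) by (intro mult_mono) (auto simp: power2_eq_square)
    then show ?thesis by (simp only: mult_1)
  qed
  have r0: "0 \<le> r * ln (real p)" unfolding r(1) using r(2) N by simp
  let ?\<mu> = "spectrum (N * ?L) N (\<lambda>j. \<Sum>k=1..p. design p j k * signal s \<tau> b k)"
  let ?M = "\<lambda>l. bin_below p (N * ?L) (\<tau> l)"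
  note bins = spectrum_at_bin_below[OF param p _ L(3) r0 dense]
  have strong: "t \<le> cmod (?\<mu> (?M l)) + x0 * sqrt ?\<Lambda>" if l: "l \<in> {1..s}" for l
  proof -
    have "harm s \<le> 1 + ln (real s)" by (rule harm_le_1_plus_ln[OF s(1)])
    also have "\<dots> \<le> 1 + ?\<Lambda>" using s by simp
    finally have f1: "8 * harm s / ?\<Lambda>\<^sup>2 \<le> 8 * (1 + ?\<Lambda>) / ?\<Lambda>\<^sup>2" by (intro divide_right_mono) auto
    have f2: "2 * pi / real ?L \<le> 2 * pi / ?\<Lambda>" using N
      by (intro divide_left_mono mult_pos_pos L(1)) (simp_all only: of_nat_0_less_iff L(3), simp_all)
    have le: "1 - 2 * pi / ?\<Lambda> - 8 * (1 + ?\<Lambda>) / ?\<Lambda>\<^sup>2 \<le> 1 - 2 * pi / real ?L - 8 * harm s / ?\<Lambda>\<^sup>2"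
      by (rule diff_mono[OF diff_mono[OF order_refl f2] f1])
    have "sqrt \<rho> * sqrt ?\<Lambda> \<le> sqrt r' * (1 - 2 * pi / ?\<Lambda> - 8 * (1 + ?\<Lambda>) / ?\<Lambda>\<^sup>2) * sqrt ?\<Lambda>"
      using mean N by (intro mult_right_mono) auto
    also have "\<dots> = sqrt (r' * ?\<Lambda>) * (1 - 2 * pi / ?\<Lambda> - 8 * (1 + ?\<Lambda>) / ?\<Lambda>\<^sup>2)"
      by (simp add: real_sqrt_mult)
    also have "\<dots> \<le> sqrt (r * ln (real p)) * (1 - 2 * pi / real ?L - 8 * harm s / ?\<Lambda>\<^sup>2)"
      unfolding r(1) using le r(2) N by (intro mult_left_mono) auto
    also have "\<dots> \<le> cmod (?\<mu> (?M l))" using N1 by (intro bins(3) l) auto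
    finally have mu: "sqrt \<rho> * sqrt ?\<Lambda> \<le> cmod (?\<mu> (?M l))" .
    have "t = sqrt c * sqrt ?\<Lambda>" by (simp add: t_def real_sqrt_mult)
    also have "\<dots> \<le> (sqrt \<rho> + x0) * sqrt ?\<Lambda>" using N unfolding x0 by (intro mult_right_mono) auto
    finally show ?thesis using mu by (simp add: distrib_right)
  qed
  have "2 * ?\<Lambda>\<^sup>2 * sqrt (real (N * ?L) * Psi_bar t) \<le>
      2 * ?\<Lambda>\<^sup>2 * sqrt (real N * (?\<Lambda> + 1) * real N powr (- c))"
    unfolding Psi using L by (intro mult_left_mono real_sqrt_le_mono mult_right_mono) (auto intro!: mult_left_mono)
  also have "\<dots> \<le> real s * (exp (- (x0 * sqrt ?\<Lambda> + 2)\<^sup>2) - Psi_bar t)"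
    using dominates by (simp add: Psi)
  also have "\<dots> \<le> (\<Sum>m=1..N * ?L. gauss_tail (?\<mu> m) t - Psi_bar t)"
  proof (rule excess_of_strong_bins[where M = ?M])
    show "0 \<le> t" using t by simp
    show "0 \<le> x0 * sqrt ?\<Lambda>" using N by (simp add: x0)
    show "inj_on ?M {1..s}" using N1 by (intro bins(1)) auto
    show "?M l \<in> {1..N * ?L}" if "l \<in> {1..s}" for l using N1 that by (intro bins(2)) auto
  qed (rule strong)
  finally show ?thesis by (rule alternative_acceptance_le[OF N(1) t])
qed

theorem theorem2p1:
  fixes \<gamma> \<alpha> r :: real and p N s :: "nat \<Rightarrow> nat"
  assumes "0 \<le> \<gamma>" and "\<gamma> < 1"
    and "(1 + \<gamma>) / 2 < \<alpha>" and "\<alpha> < 1"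
    and "0 < r"
    and "filterlim p at_top sequentially"
    and "\<And>n. 0 < p n"
    and "\<And>n. real (N n) = real (p n) powr (1 - \<gamma>)"
    and "\<And>n. real (s n) = real (p n) powr (1 - \<alpha>)"
    and "r > detection_boundary \<gamma> \<alpha>"
  shows "(\<lambda>n. \<P>(y in obs_law (p n) (N n) (\<lambda>_. 0). ophc_rejects (N n) y) +
              (SUP (\<tau>, b) \<in> param_space (p n) (N n) (s n) r.
                 \<P>(y in obs_law (p n) (N n) (signal (s n) \<tau> b). \<not> ophc_rejects (N n) y)))
         \<longlonglongrightarrow> 0"
proof -
  define \<sigma> where "\<sigma> = (1 - \<alpha>) / (1 - \<gamma>)"
  define r' where "r' = r / (1 - \<gamma>)"
  have \<sigma>: "0 < \<sigma>" "\<sigma> < 1 / 2" using assms(2-4) by (auto simp: \<sigma>_def field_simps)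
  have r': "0 < r'" using assms(2,5) by (simp add: r'_def)
  obtain c \<rho> where c: "0 < c" "c < 1" and \<rho>: "0 < \<rho>" "\<rho> < r'"
    and x0c: "(max 0 (sqrt c - sqrt \<rho>))\<^sup>2 < c" "(1 - c) / 2 < \<sigma> - (max 0 (sqrt c - sqrt \<rho>))\<^sup>2"
    using exponents_exist[OF \<sigma>, of r'] detection_boundary_rescaled[OF assms(1,2,4,10)]
    unfolding \<sigma>_def r'_def by metis
  define x0 where "x0 = max 0 (sqrt c - sqrt \<rho>)"
  have "sqrt c \<le> 1" "0 < sqrt \<rho>" using c \<rho> by auto
  then have x0: "0 \<le> x0" "x0 \<le> 1" unfolding x0_def by linarith+

  have N_lim: "filterlim (\<lambda>n. real (N n)) at_top sequentially"
  proof -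
    have "filterlim (\<lambda>x::real. x powr (1 - \<gamma>)) at_top at_top" using assms(2) by real_asymp
    then show ?thesis unfolding assms(8)
      by (rule filterlim_compose) (rule filterlim_compose[OF filterlim_real_sequentially assms(6)])
  qed
  have s_N: "real (s n) = real (N n) powr \<sigma>" for n
    using assms(2) by (simp add: assms(8,9) powr_powr \<sigma>_def)
  have ln_p: "r * ln (real (p n)) = r' * ln (real (N n))" for n
    using assms(2,7) by (simp add: assms(8) ln_powr r'_def)

  define g where "g x = (ln x + 1) * x * exp (2 - (ln x)\<^sup>2 / sqrt (3 * (ln x + 1))) + 5 * (ln x + 1) / (ln x)\<^sup>2"
    for x :: real
  have g_lim: "(g \<longlongrightarrow> 0) at_top" unfolding g_def by real_asymp

  have ev_mean: "\<forall>\<^sub>F x in at_top. sqrt \<rho> \<le> sqrt r' * (1 - 2 * pi / ln x - 8 * (1 + ln x) / (ln x)\<^sup>2)"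
  proof -
    have "((\<lambda>x::real. 1 - 2 * pi / ln x - 8 * (1 + ln x) / (ln x)\<^sup>2) \<longlongrightarrow> 1) at_top" by real_asymp
    moreover have "sqrt \<rho> / sqrt r' < 1" using \<rho> r' by simp
    ultimately have "\<forall>\<^sub>F x in at_top. sqrt \<rho> / sqrt r' < 1 - 2 * pi / ln x - 8 * (1 + ln x) / (ln x)\<^sup>2"
      by (rule order_tendstoD(1))
    then show ?thesis
      by eventually_elim (use r' in \<open>simp add: pos_divide_less_eq mult.commute\<close>)
  qed
  have ev: "\<forall>\<^sub>F x in at_top. (9 \<le> x \<and> 2 \<le> ln x) \<and> (1 \<le> c * ln x \<and> c * ln x \<le> ln (x / 3)) \<and>
      2 * x powr \<sigma> * (ln x)\<^sup>2 \<le> x"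
  proof (intro eventually_conj)
    show "\<forall>\<^sub>F x in at_top. c * ln x \<le> ln (x / 3)" using c by real_asymp
    show "\<forall>\<^sub>F x in at_top. 1 \<le> c * ln x" using c by real_asymp
    show "\<forall>\<^sub>F x in at_top. 2 * x powr \<sigma> * (ln x)\<^sup>2 \<le> x" using \<sigma> by real_asymp
    show "\<forall>\<^sub>F x::real in at_top. 2 \<le> ln x" by real_asymp
  qed (rule eventually_ge_at_top)
  have ev_dom: "\<forall>\<^sub>F x in at_top. 2 * (ln x)\<^sup>2 * sqrt (x * (ln x + 1) * x powr (- c)) \<le>
      x powr \<sigma> * (exp (- (x0 * sqrt (ln x) + 2)\<^sup>2) - x powr (- c))"
    using x0 x0c unfolding x0_def[symmetric] by (intro eventually_signal_dominates) auto

  let ?err = "\<lambda>n. \<P>(y in obs_law (p n) (N n) (\<lambda>_. 0). ophc_rejects (N n) y) +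
              (SUP (\<tau>, b) \<in> param_space (p n) (N n) (s n) r.
                 \<P>(y in obs_law (p n) (N n) (signal (s n) \<tau> b). \<not> ophc_rejects (N n) y))"
  have bounds: "\<forall>\<^sub>F n in sequentially. 0 \<le> ?err n \<and> ?err n \<le> g (real (N n))"
    using eventually_compose_filterlim[OF ev_mean N_lim] eventually_compose_filterlim[OF ev N_lim]
      eventually_compose_filterlim[OF ev_dom N_lim]
  proof eventually_elim
    case (elim n)
    let ?N = "real (N n)" and ?L = "oversampling (N n)"
    have N9: "9 \<le> N n" using elim by simp
    have "1 \<le> N n" using N9 by simp
    from oversampling_bounds[OF this]
    have L: "real ?L \<le> ln ?N + 1" "0 < real ?L" by (simp_all only: of_nat_0_less_iff)
    have pn: "0 < p n" "1 \<le> real (p n)" using assms(7)[of n] by auto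
    have "?N \<le> real (p n) powr 1" unfolding assms(8) using assms(1) pn by (intro powr_mono) auto
    then have Np: "N n \<le> p n" using pn by simp
    have s0: "0 < s n" using s_N[of n] N9 by (metis of_nat_0_less_iff powr_gt_zero not_numeral_le_zero gr0I less_irrefl of_nat_0)
    have "?N powr \<sigma> \<le> ?N powr 1" using \<sigma> N9 by (intro powr_mono) auto
    then have sN: "s n \<le> N n" using s_N[of n] N9 by simp
    let ?f = "\<lambda>\<tau> b. \<P>(y in obs_law (p n) (N n) (signal (s n) \<tau> b). \<not> ophc_rejects (N n) y)"
    have miss: "?f \<tau> b \<le> 5 * (ln ?N + 1) / (ln ?N)\<^sup>2"
      if "(\<tau>, b) \<in> param_space (p n) (N n) (s n) r" for \<tau> b
    proof -
      have "?f \<tau> b \<le> 5 * real ?L / (ln ?N)\<^sup>2"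
        using elim c \<rho> r' s_N[of n]
        by (intro uniform_acceptance_le[OF N9 _ pn(1) s0 sN that c(1) _ _ _ ln_p _ _ x0_def]) auto
      also have "\<dots> \<le> 5 * (ln ?N + 1) / (ln ?N)\<^sup>2" using L by (intro divide_right_mono) auto
      finally show ?thesis .
    qed
    have ne: "param_space (p n) (N n) (s n) r \<noteq> {}"
      using elim N9 assms(5) s_N[of n] by (intro param_space_nonempty s0 pn Np) auto
    then obtain \<tau>0 b0 where mem: "(\<tau>0, b0) \<in> param_space (p n) (N n) (s n) r" by auto
    let ?sup = "SUP (\<tau>, b) \<in> param_space (p n) (N n) (s n) r. ?f \<tau> b"
    have sup_le: "?sup \<le> 5 * (ln ?N + 1) / (ln ?N)\<^sup>2"
      using ne miss by (intro cSUP_least) auto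
    have "bdd_above ((\<lambda>(\<tau>, b). ?f \<tau> b) ` param_space (p n) (N n) (s n) r)"
      by (rule bdd_aboveI2[where M = "5 * (ln ?N + 1) / (ln ?N)\<^sup>2"])
         (use miss in \<open>simp only: split_paired_all prod.case\<close>)
    from cSUP_upper[OF mem this] have "?f \<tau>0 b0 \<le> ?sup" by simp
    then have sup_ge: "0 \<le> ?sup" using measure_nonneg order_trans by blast
    have "\<P>(y in obs_law (p n) (N n) (\<lambda>_. 0). ophc_rejects (N n) y) \<le>
        real ?L * ?N * exp (2 - (ln ?N)\<^sup>2 / sqrt (3 * real ?L))"
      by (rule null_rejection_le[OF N9])
    also have "\<dots> \<le> (ln ?N + 1) * ?N * exp (2 - (ln ?N)\<^sup>2 / sqrt (3 * (ln ?N + 1)))"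
    proof -
      have pos: "0 < sqrt (3 * real ?L)" by (intro real_sqrt_gt_zero mult_pos_pos L(2)) simp
      have le: "sqrt (3 * real ?L) \<le> sqrt (3 * (ln ?N + 1))"
        by (intro real_sqrt_le_mono mult_left_mono L(1)) simp
      have "(ln ?N)\<^sup>2 / sqrt (3 * (ln ?N + 1)) \<le> (ln ?N)\<^sup>2 / sqrt (3 * real ?L)"
        by (rule divide_left_mono[OF le _ mult_pos_pos[OF less_le_trans[OF pos le] pos]]) simp
      then show ?thesis
        using N9 by (intro mult_mono mult_right_mono L(1) mult_nonneg_nonneg) auto
    qed
    finally show ?case
      using sup_le sup_ge measure_nonneg[of "obs_law (p n) (N n) (\<lambda>_. 0)"] by (auto simp: g_def intro: add_nonneg_nonneg)
  qed
  show ?thesis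
  proof (rule tendsto_sandwich)
    show "\<forall>\<^sub>F n in sequentially. 0 \<le> ?err n" "\<forall>\<^sub>F n in sequentially. ?err n \<le> g (real (N n))"
      using bounds by (auto elim: eventually_mono)
    show "(\<lambda>n. g (real (N n))) \<longlonglongrightarrow> 0" by (rule filterlim_compose[OF g_lim N_lim])
  qed simp
qed

end
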